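(* Let $R$ be a ring, $M$ a nonzero uniformly finite $R$-module, $N$ a submodule of $M$ with $N\neq M$, and $N=N_1\cap\cdots\cap N_n$ a shortest uniform decomposition of $N$ in $M$. Then: 1. the module $M/N$ contains a direct sum $U_1\oplus\cdots\oplus U_n$ of uniform submodules with $\operatorname{As}_R(M/N_i)=\{[U_i]\}$ for each $i=1,\ldots,n$; and 2. (for these $U_1,\ldots,U_n$) for each $i=1,\ldots,n$ there exists a complement $C_i$ of $U_i$ in $M/N$ containing $\sum_{j\neq i}U_j$ such that $\sum_{j\neq i}U_j\subseteq N_i/N\subseteq C_i$. In this way all the shortest uniform decompositions of $N$ in $M$ are obtained. In more detail, suppose given 3. any direct sum $U_1'\oplus\cdots\oplus U_n'\subseteq M/N$ of uniform submodules (note that $n=\operatorname{u.dim}(M/N)$); 4. for each $i=1,\ldots,n$, a complement $C_i'$ of $U_i'$ in $M/N$ that contains $\sum_{j\neq i}U_j'$; and 5. for each $i=1,\ldots,n$, a submodule $N_i'$ of $M$ containing $N$ such that $M/N_i'$ is a uniform module and $\sum_{j\neq i}U_j'\subseteq N_i'/N\subseteq C_i'$. Then $N=N_1'\cap\cdots\cap N_n'$ is a shortest uniform decomposition of $N$ in $M$. In particular, $N=N_1'\cap\cdots\cap N_n'$ is an irredundant primary decomposition of $N$ in $M$.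
   Context: Rings have $1$ and need not be commutative; module means left module. A submodule $N$ of $M$ is essential if $N\cap L\neq 0$ for every nonzero submodule $L$ of $M$. A module $U$ is uniform if $U\neq 0$ and every nonzero submodule of $U$ is essential in $U$. A module has finite uniform dimension if it contains no infinite direct sum of nonzero submodules; then $\operatorname{u.dim}(M)$ is the number of summands in any essential direct sum of uniform submodules of $M$ ($0$ if $M=0$). Modules $M_1,M_2$ are essentially equivalent if there are essential submodules $L_1\subseteq M_1$, $L_2\subseteq M_2$ with $L_1\simeq L_2$; $[M]$ denotes the equivalence class of $M$. For a module $M$ of finite uniform dimension, $\operatorname{As}_R(M)=\{[U] : U \text{ is a uniform submodule of } M\}$. An $R$-module $M$ is uniformly finite if every factor module of $M$ has finite uniform dimension. A submodule $N$ of $M$ is primary if $\operatorname{u.dim}(M/N)<\infty$ and $\operatorname{As}_R(M/N)$ consists of a single element. A primary decomposition of $N$ in $M$ is an expression $N=N_1\cap\cdots\cap N_s$ ($s\ge 1$ finite) with each $N_i$ a primary submodule of $M$; it is irredundant if no $N_i$ can be dropped without changing the intersection. A uniform decomposition of $N$ in $M$ is an expression $N=N_1\cap\cdots\cap N_s$ ($s\geq 1$ finite) with submodules $N_i$ of $M$ such that each $M/N_i$ is a uniform module; it is shortest if $s=\operatorname{u.dim}(M/N)$. A complement to (or of) a submodule $A$ in a module $Q$ is a submodule $C$ of $Q$ that is maximal with respect to the property $A\cap C=0$. Empty sums of submodules are $0$. *)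

theory Defs
  imports "HOL-Algebra.Module" "HOL-Algebra.AbelCoset"
begin

text \<open>
  The locale \<open>module\<close> of HOL-Algebra requires a commutative ring of scalars.  The locale below
  has the same module axioms over an arbitrary unital ring.  Submodules are the library's
  \<open>submodule\<close>, which does not refer to commutativity.  As in the library, a submodule is a set,
  and \<open>M\<lparr>carrier := L\<rparr>\<close> is the submodule \<open>L\<close> regarded as a module.
\<close>

locale left_module = R?: ring R + M?: abelian_group M for R (structure) and M (structure) +
  assumes smult_closed [simp, intro]:
      "\<lbrakk>a \<in> carrier R; x \<in> carrier M\<rbrakk> \<Longrightarrow> a \<odot>\<^bsub>M\<^esub> x \<in> carrier M"
    and smult_l_distr:
      "\<lbrakk>a \<in> carrier R; b \<in> carrier R; x \<in> carrier M\<rbrakk> \<Longrightarrow>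
        (a \<oplus>\<^bsub>R\<^esub> b) \<odot>\<^bsub>M\<^esub> x = a \<odot>\<^bsub>M\<^esub> x \<oplus>\<^bsub>M\<^esub> b \<odot>\<^bsub>M\<^esub> x"
    and smult_r_distr:
      "\<lbrakk>a \<in> carrier R; x \<in> carrier M; y \<in> carrier M\<rbrakk> \<Longrightarrow>
        a \<odot>\<^bsub>M\<^esub> (x \<oplus>\<^bsub>M\<^esub> y) = a \<odot>\<^bsub>M\<^esub> x \<oplus>\<^bsub>M\<^esub> a \<odot>\<^bsub>M\<^esub> y"
    and smult_assoc1:
      "\<lbrakk>a \<in> carrier R; b \<in> carrier R; x \<in> carrier M\<rbrakk> \<Longrightarrow>
        (a \<otimes>\<^bsub>R\<^esub> b) \<odot>\<^bsub>M\<^esub> x = a \<odot>\<^bsub>M\<^esub> (b \<odot>\<^bsub>M\<^esub> x)"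
    and smult_one [simp]:
      "x \<in> carrier M \<Longrightarrow> \<one>\<^bsub>R\<^esub> \<odot>\<^bsub>M\<^esub> x = x"

lemma left_module_iff_module:
  "cring R \<Longrightarrow> left_module R M \<longleftrightarrow> module R M"
  by (auto simp: left_module_def left_module_axioms_def module_def module_axioms_def
      cring.axioms)

subsection \<open>Factor modules\<close>

text \<open>
  The fields \<open>mult\<close> and \<open>one\<close> belong to the record type of modules only because it extends the
  record type of rings; they play no role for modules.
\<close>

definition quot_module ::
    "('r, 'm, 'x) module_scheme \<Rightarrow> 'm set \<Rightarrow> ('r, 'm set) module" (infixl \<open>QuotMod\<close> 65)
  where "M QuotMod N =
    \<lparr>carrier = a_rcosets\<^bsub>M\<^esub> N, mult = undefined, one = undefined, zero = N, add = set_add M,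
     smult = (\<lambda>a X. \<Union>x\<in>X. N +>\<^bsub>M\<^esub> (a \<odot>\<^bsub>M\<^esub> x))\<rparr>"

lemma (in left_module) quot_module_left_module:
  assumes "submodule N R M"
  shows "left_module R (M QuotMod N)"
proof -
  interpret N: submodule N R M by fact
  interpret A: abelian_subgroup N M
    by (intro abelian_subgroupI3 additive_subgroup.intro N.subgroup_axioms M.abelian_group_axioms)
  have sub: "N \<subseteq> carrier M" by (rule A.a_subset)
  have add: "(N +>\<^bsub>M\<^esub> x) \<oplus>\<^bsub>M QuotMod N\<^esub> (N +>\<^bsub>M\<^esub> y) = N +>\<^bsub>M\<^esub> (x \<oplus>\<^bsub>M\<^esub> y)"
    if "x \<in> carrier M" "y \<in> carrier M" for x y
    using that by (simp add: quot_module_def A.a_rcos_sum)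
  have carI: "N +>\<^bsub>M\<^esub> x \<in> carrier (M QuotMod N)" if "x \<in> carrier M" for x
    using that by (auto simp: quot_module_def A_RCOSETS_def')
  have carE: thesis
    if "X \<in> carrier (M QuotMod N)" "\<And>x. x \<in> carrier M \<Longrightarrow> X = N +>\<^bsub>M\<^esub> x \<Longrightarrow> thesis" for X thesis
    using that by (auto simp: quot_module_def A_RCOSETS_def')
  have sm: "a \<odot>\<^bsub>M QuotMod N\<^esub> (N +>\<^bsub>M\<^esub> x) = N +>\<^bsub>M\<^esub> (a \<odot>\<^bsub>M\<^esub> x)"
    if a: "a \<in> carrier R" and x: "x \<in> carrier M" for a x
  proof -
    have "N +>\<^bsub>M\<^esub> (a \<odot>\<^bsub>M\<^esub> y) = N +>\<^bsub>M\<^esub> (a \<odot>\<^bsub>M\<^esub> x)" if "y \<in> N +>\<^bsub>M\<^esub> x" for y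
    proof -
      obtain h where h: "h \<in> N" "y = h \<oplus>\<^bsub>M\<^esub> x"
        using \<open>y \<in> _\<close> by (auto simp: a_r_coset_def')
      then have "a \<odot>\<^bsub>M\<^esub> y = a \<odot>\<^bsub>M\<^esub> h \<oplus>\<^bsub>M\<^esub> a \<odot>\<^bsub>M\<^esub> x" "a \<odot>\<^bsub>M\<^esub> h \<in> N"
        using a x sub by (auto intro: smult_r_distr)
      then have "a \<odot>\<^bsub>M\<^esub> y \<in> N +>\<^bsub>M\<^esub> (a \<odot>\<^bsub>M\<^esub> x)" by (auto simp: a_r_coset_def')
      then show ?thesis
        using a_repr_independence[OF _ _ A.a_subgroup] a x smult_closed by metis
    qed
    moreover have "x \<in> N +>\<^bsub>M\<^esub> x" using A.a_rcos_self x by blast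
    ultimately have "(\<Union>y\<in>N +>\<^bsub>M\<^esub> x. N +>\<^bsub>M\<^esub> (a \<odot>\<^bsub>M\<^esub> y)) = N +>\<^bsub>M\<^esub> (a \<odot>\<^bsub>M\<^esub> x)"
      by blast
    then show ?thesis by (simp add: quot_module_def)
  qed
  have zero: "\<zero>\<^bsub>M QuotMod N\<^esub> = N +>\<^bsub>M\<^esub> \<zero>\<^bsub>M\<^esub>"
    using sub by (simp add: quot_module_def)
  have AG: "abelian_group (M QuotMod N)"
  proof (rule abelian_groupI)
    show "\<exists>Y\<in>carrier (M QuotMod N). Y \<oplus>\<^bsub>M QuotMod N\<^esub> X = \<zero>\<^bsub>M QuotMod N\<^esub>"
      if "X \<in> carrier (M QuotMod N)" for X
    proof -
      obtain x where "x \<in> carrier M" "X = N +>\<^bsub>M\<^esub> x" using \<open>X \<in> _\<close> by (rule carE)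
      then show ?thesis
        by (intro bexI[of _ "N +>\<^bsub>M\<^esub> (\<ominus>\<^bsub>M\<^esub> x)"]) (auto simp: zero add M.l_neg intro: carI)
    qed
  qed (auto simp: add zero carI M.a_assoc M.a_comm M.a_lcomm elim!: carE)
  show ?thesis
    by (intro left_module.intro left_module_axioms.intro R.ring_axioms AG)
       (auto simp: sm add smult_l_distr smult_r_distr smult_assoc1 simp: carI elim!: carE)
qed

text \<open>The submodule \<open>K/N\<close> of \<open>M/N\<close>, for a submodule \<open>K\<close> of \<open>M\<close> containing \<open>N\<close>.\<close>

definition quot_submodule ::
    "('r, 'm, 'x) module_scheme \<Rightarrow> 'm set \<Rightarrow> 'm set \<Rightarrow> 'm set set"
  where "quot_submodule M K N = (\<lambda>x. N +>\<^bsub>M\<^esub> x) ` K"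

subsection \<open>Essential and uniform submodules, complements\<close>

definition nonzero_submodule ::
    "('r, 's) ring_scheme \<Rightarrow> ('r, 'm, 'x) module_scheme \<Rightarrow> 'm set \<Rightarrow> bool"
  where "nonzero_submodule R M L \<longleftrightarrow> submodule L R M \<and> L \<noteq> {\<zero>\<^bsub>M\<^esub>}"

definition essential_submodule ::
    "('r, 's) ring_scheme \<Rightarrow> ('r, 'm, 'x) module_scheme \<Rightarrow> 'm set \<Rightarrow> bool"
  where "essential_submodule R M N \<longleftrightarrow>
    submodule N R M \<and> (\<forall>L. nonzero_submodule R M L \<longrightarrow> N \<inter> L \<noteq> {\<zero>\<^bsub>M\<^esub>})"

definition uniform_module ::
    "('r, 's) ring_scheme \<Rightarrow> ('r, 'm, 'x) module_scheme \<Rightarrow> bool"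
  where "uniform_module R U \<longleftrightarrow>
    carrier U \<noteq> {\<zero>\<^bsub>U\<^esub>} \<and> (\<forall>L. nonzero_submodule R U L \<longrightarrow> essential_submodule R U L)"

definition uniform_submodule ::
    "('r, 's) ring_scheme \<Rightarrow> ('r, 'm, 'x) module_scheme \<Rightarrow> 'm set \<Rightarrow> bool"
  where "uniform_submodule R M U \<longleftrightarrow> submodule U R M \<and> uniform_module R (M\<lparr>carrier := U\<rparr>)"

definition complement_of ::
    "('r, 's) ring_scheme \<Rightarrow> ('r, 'm, 'x) module_scheme \<Rightarrow> 'm set \<Rightarrow> 'm set \<Rightarrow> bool"
  where "complement_of R Q A C \<longleftrightarrow>
    submodule C R Q \<and> A \<inter> C = {\<zero>\<^bsub>Q\<^esub>} \<and>
    (\<forall>D. submodule D R Q \<and> A \<inter> D = {\<zero>\<^bsub>Q\<^esub>} \<and> C \<subseteq> D \<longrightarrow> D = C)"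

subsection \<open>Sums, direct sums and uniform dimension\<close>

definition submodule_sum ::
    "('r, 'm, 'x) module_scheme \<Rightarrow> 'i set \<Rightarrow> ('i \<Rightarrow> 'm set) \<Rightarrow> 'm set"
  where "submodule_sum M I L =
    {finsum M f F | f F. finite F \<and> F \<subseteq> I \<and> (\<forall>i\<in>F. f i \<in> L i)}"

definition direct_sum ::
    "('r, 'm, 'x) module_scheme \<Rightarrow> 'i set \<Rightarrow> ('i \<Rightarrow> 'm set) \<Rightarrow> bool"
  where "direct_sum M I L \<longleftrightarrow>
    (\<forall>i\<in>I. L i \<inter> submodule_sum M (I - {i}) L = {\<zero>\<^bsub>M\<^esub>})"

text \<open>
  The members of a direct sum of nonzero submodules are pairwise distinct, so such a family
  may be indexed by the set of its members.
\<close>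

definition finite_udim ::
    "('r, 's) ring_scheme \<Rightarrow> ('r, 'm, 'x) module_scheme \<Rightarrow> bool"
  where "finite_udim R M \<longleftrightarrow>
    \<not> (\<exists>\<L>. infinite \<L> \<and> (\<forall>L\<in>\<L>. nonzero_submodule R M L) \<and> direct_sum M \<L> (\<lambda>L. L))"

text \<open>
  Meaningful for modules of finite uniform dimension only.  The zero module has uniform
  dimension \<open>0\<close>, given by the empty direct sum.
\<close>

definition udim ::
    "('r, 's) ring_scheme \<Rightarrow> ('r, 'm, 'x) module_scheme \<Rightarrow> nat"
  where "udim R M =
    (THE n. \<exists>U :: nat \<Rightarrow> 'm set.
       (\<forall>i\<in>{1..n}. uniform_submodule R M (U i)) \<and> direct_sum M {1..n} U \<and>
       essential_submodule R M (submodule_sum M {1..n} U))"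

definition uniformly_finite ::
    "('r, 's) ring_scheme \<Rightarrow> ('r, 'm, 'x) module_scheme \<Rightarrow> bool"
  where "uniformly_finite R M \<longleftrightarrow> (\<forall>N. submodule N R M \<longrightarrow> finite_udim R (M QuotMod N))"

subsection \<open>Essential equivalence and associated classes\<close>

definition module_iso ::
    "('r, 's) ring_scheme \<Rightarrow> ('r, 'm, 'x) module_scheme \<Rightarrow> ('r, 'n, 'y) module_scheme \<Rightarrow> ('m \<Rightarrow> 'n) set"
  where "module_iso R M N =
    {h \<in> iso (add_monoid M) (add_monoid N).
       \<forall>a\<in>carrier R. \<forall>x\<in>carrier M. h (a \<odot>\<^bsub>M\<^esub> x) = a \<odot>\<^bsub>N\<^esub> h x}"

definition essentially_equivalent ::
    "('r, 's) ring_scheme \<Rightarrow> ('r, 'm, 'x) module_scheme \<Rightarrow> ('r, 'n, 'y) module_scheme \<Rightarrow> bool"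
  where "essentially_equivalent R M1 M2 \<longleftrightarrow>
    (\<exists>L1 L2. essential_submodule R M1 L1 \<and> essential_submodule R M2 L2 \<and>
       module_iso R (M1\<lparr>carrier := L1\<rparr>) (M2\<lparr>carrier := L2\<rparr>) \<noteq> {})"

text \<open>
  The class \<open>[M]\<close> is formed among the modules whose elements have the same type as those of
  \<open>M\<close>.  All factor modules of one module have elements of the same type, so classes of
  submodules of different factor modules can be compared.
\<close>

definition ess_class ::
    "('r, 's) ring_scheme \<Rightarrow> ('r, 'm, 'x) module_scheme \<Rightarrow> ('r, 'm, 'x) module_scheme set"
  where "ess_class R M = {V. left_module R V \<and> essentially_equivalent R M V}"

definition As ::
    "('r, 's) ring_scheme \<Rightarrow> ('r, 'm, 'x) module_scheme \<Rightarrow> ('r, 'm, 'x) module_scheme set set"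
  where "As R M = {ess_class R (M\<lparr>carrier := U\<rparr>) | U. uniform_submodule R M U}"

subsection \<open>Primary and uniform decompositions\<close>

definition primary_submodule ::
    "('r, 's) ring_scheme \<Rightarrow> ('r, 'm, 'x) module_scheme \<Rightarrow> 'm set \<Rightarrow> bool"
  where "primary_submodule R M N \<longleftrightarrow>
    submodule N R M \<and> finite_udim R (M QuotMod N) \<and> (\<exists>c. As R (M QuotMod N) = {c})"

definition primary_decomposition ::
    "('r, 's) ring_scheme \<Rightarrow> ('r, 'm, 'x) module_scheme \<Rightarrow> 'm set \<Rightarrow> nat \<Rightarrow> (nat \<Rightarrow> 'm set) \<Rightarrow> bool"
  where "primary_decomposition R M N s Ns \<longleftrightarrow>
    s \<ge> 1 \<and> (\<forall>i\<in>{1..s}. primary_submodule R M (Ns i)) \<and> N = (\<Inter>i\<in>{1..s}. Ns i)"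

text \<open>
  Intersecting with \<open>carrier M\<close> makes the intersection of the empty family of submodules of
  \<open>M\<close>, which occurs for \<open>s = 1\<close>, equal to \<open>M\<close>.
\<close>

definition irredundant ::
    "('r, 'm, 'x) module_scheme \<Rightarrow> 'm set \<Rightarrow> nat \<Rightarrow> (nat \<Rightarrow> 'm set) \<Rightarrow> bool"
  where "irredundant M N s Ns \<longleftrightarrow>
    (\<forall>i\<in>{1..s}. carrier M \<inter> (\<Inter>j\<in>{1..s} - {i}. Ns j) \<noteq> N)"

definition uniform_decomposition ::
    "('r, 's) ring_scheme \<Rightarrow> ('r, 'm, 'x) module_scheme \<Rightarrow> 'm set \<Rightarrow> nat \<Rightarrow> (nat \<Rightarrow> 'm set) \<Rightarrow> bool"
  where "uniform_decomposition R M N s Ns \<longleftrightarrow>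
    s \<ge> 1 \<and> (\<forall>i\<in>{1..s}. submodule (Ns i) R M \<and> uniform_module R (M QuotMod (Ns i))) \<and>
    N = (\<Inter>i\<in>{1..s}. Ns i)"

definition shortest_uniform_decomposition ::
    "('r, 's) ring_scheme \<Rightarrow> ('r, 'm, 'x) module_scheme \<Rightarrow> 'm set \<Rightarrow> nat \<Rightarrow> (nat \<Rightarrow> 'm set) \<Rightarrow> bool"
  where "shortest_uniform_decomposition R M N s Ns \<longleftrightarrow>
    uniform_decomposition R M N s Ns \<and> s = udim R (M QuotMod N)"

end

theory Submission
  imports Defs
begin

text \<open>
  Call a submodule meet-irreducible if it is proper and not the intersection of two strictly larger
  submodules; \<open>M/A\<close> is uniform iff \<open>A\<close> is meet-irreducible, and complements of uniform submodules
  are meet-irreducible.  If \<open>m\<close> meet-irreducible submodules of \<open>Q = M/N\<close> intersect in zero, then every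
  direct sum of nonzero submodules of \<open>Q\<close> has at most \<open>m\<close> terms.  This one bound yields the
  invariance of the uniform dimension, the irredundancy of the shortest decompositions and the
  essentiality of direct sums of \<open>n = u.dim Q\<close> nonzero submodules.

  For the first part take \<open>U\<^sub>i = (\<Inter>j\<noteq>i. N\<^sub>j)/N\<close>.  It is nonzero and meets \<open>N\<^sub>i/N\<close> in zero, so it embeds
  in the uniform module \<open>M/N\<^sub>i\<close>; a complement of \<open>U\<^sub>i\<close> above \<open>N\<^sub>i/N\<close> exists by Zorn's lemma.
  For the converse, let \<open>u = \<Sum>u\<^sub>j\<close> be an element of the essential submodule \<open>\<Oplus>U\<^sub>j'\<close> lying in every
  \<open>N\<^sub>i'/N\<close>.  Subtracting the terms with \<open>j \<noteq> i\<close>, which lie in \<open>N\<^sub>i'/N\<close>, shows \<open>u\<^sub>i \<in> U\<^sub>i' \<inter> C\<^sub>i' = 0\<close>.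
\<close>

subsection \<open>Submodules and their sums\<close>

context left_module
begin

section \<open>Arithmetic in a module and closure of submodules\<close>

lemma minus_eq_zero_iff: "x \<in> carrier M \<Longrightarrow> y \<in> carrier M \<Longrightarrow> x \<ominus>\<^bsub>M\<^esub> y = \<zero>\<^bsub>M\<^esub> \<longleftrightarrow> x = y"
  using M.minus_equality[of x "\<ominus>\<^bsub>M\<^esub> y"] by (auto simp: a_minus_def M.r_neg)

lemma add_minus_cancel:
  assumes "x \<in> carrier M" "y \<in> carrier M"
  shows "(x \<oplus>\<^bsub>M\<^esub> y) \<ominus>\<^bsub>M\<^esub> x = y" "(x \<oplus>\<^bsub>M\<^esub> y) \<ominus>\<^bsub>M\<^esub> y = x"
  using assms by (simp_all add: a_minus_def M.a_assoc M.a_comm[of y "\<ominus>\<^bsub>M\<^esub> x"] M.r_neg M.r_neg2)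

lemma smult_zero_left: "x \<in> carrier M \<Longrightarrow> \<zero> \<odot>\<^bsub>M\<^esub> x = \<zero>\<^bsub>M\<^esub>"
  using smult_l_distr[of \<zero> \<zero> x] by simp

lemma smult_zero_right: "a \<in> carrier R \<Longrightarrow> a \<odot>\<^bsub>M\<^esub> \<zero>\<^bsub>M\<^esub> = \<zero>\<^bsub>M\<^esub>"
  using smult_r_distr[of a "\<zero>\<^bsub>M\<^esub>" "\<zero>\<^bsub>M\<^esub>"] by simp

lemma minus_one_smult:
  assumes "x \<in> carrier M"
  shows "(\<ominus> \<one>) \<odot>\<^bsub>M\<^esub> x = \<ominus>\<^bsub>M\<^esub> x"
proof -
  have "(\<ominus> \<one>) \<odot>\<^bsub>M\<^esub> x \<oplus>\<^bsub>M\<^esub> \<one> \<odot>\<^bsub>M\<^esub> x = \<zero>\<^bsub>M\<^esub>"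
    using assms by (simp add: smult_l_distr[symmetric] R.l_neg smult_zero_left del: smult_one)
  then show ?thesis
    using assms by (simp add: M.minus_equality)
qed

text \<open>Negatives come from scalar multiplication by \<open>- 1\<close>, which supplies the
  inverses demanded of a subgroup.\<close>

lemma submoduleI:
  assumes "X \<subseteq> carrier M" "\<zero>\<^bsub>M\<^esub> \<in> X"
    and "\<And>x y. x \<in> X \<Longrightarrow> y \<in> X \<Longrightarrow> x \<oplus>\<^bsub>M\<^esub> y \<in> X"
    and smult: "\<And>a x. a \<in> carrier R \<Longrightarrow> x \<in> X \<Longrightarrow> a \<odot>\<^bsub>M\<^esub> x \<in> X"
  shows "submodule X R M"
proof (intro submodule.intro subgroup.intro submodule_axioms.intro)
  show "inv\<^bsub>add_monoid M\<^esub> x \<in> X" if "x \<in> X" for x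
  proof -
    have "\<ominus>\<^bsub>M\<^esub> x \<in> X"
      using smult[of "\<ominus> \<one>" x] that assms(1) by (simp add: minus_one_smult subset_iff)
    then show ?thesis by (simp add: a_inv_def)
  qed
qed (use assms in auto)

lemma submoduleD:
  assumes "submodule X R M"
  shows "X \<subseteq> carrier M" "\<zero>\<^bsub>M\<^esub> \<in> X"
    and "x \<in> X \<Longrightarrow> y \<in> X \<Longrightarrow> x \<oplus>\<^bsub>M\<^esub> y \<in> X"
    and "a \<in> carrier R \<Longrightarrow> x \<in> X \<Longrightarrow> a \<odot>\<^bsub>M\<^esub> x \<in> X"
    and "x \<in> X \<Longrightarrow> \<ominus>\<^bsub>M\<^esub> x \<in> X"
    and "x \<in> X \<Longrightarrow> y \<in> X \<Longrightarrow> x \<ominus>\<^bsub>M\<^esub> y \<in> X"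
proof -
  interpret submodule X R M by fact
  show sub: "X \<subseteq> carrier M" using subset by simp
  show "\<zero>\<^bsub>M\<^esub> \<in> X" using one_closed by simp
  show add: "x \<oplus>\<^bsub>M\<^esub> y \<in> X" if "x \<in> X" "y \<in> X" for x y using m_closed that by simp
  show smult: "a \<odot>\<^bsub>M\<^esub> x \<in> X" if "a \<in> carrier R" "x \<in> X" for a x using that by simp
  show neg: "\<ominus>\<^bsub>M\<^esub> x \<in> X" if "x \<in> X" for x
    using that sub by (subst minus_one_smult[symmetric]) auto
  show "x \<ominus>\<^bsub>M\<^esub> y \<in> X" if "x \<in> X" "y \<in> X"
    using that add neg by (simp add: a_minus_def)
qed

lemma submodule_carrier: "submodule (carrier M) R M"
  by (rule submoduleI) auto

lemma submodule_zero: "submodule {\<zero>\<^bsub>M\<^esub>} R M"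
  by (rule submoduleI) (auto simp: smult_zero_right)

lemma submodule_Int: "submodule X R M \<Longrightarrow> submodule Y R M \<Longrightarrow> submodule (X \<inter> Y) R M"
  using submoduleD(1)[of X] by (intro submoduleI) (auto intro: submoduleD(2-4))

text \<open>Intersecting with \<open>carrier M\<close> gives the whole module for the empty index
  set, where the bare intersection would be the whole type.\<close>

lemma submodule_INT:
  "(\<And>i. i \<in> I \<Longrightarrow> submodule (A i) R M) \<Longrightarrow> submodule (carrier M \<inter> (\<Inter>i\<in>I. A i)) R M"
  by (rule submoduleI) (auto intro: submoduleD(2-4))

section \<open>Sums of two submodules\<close>

lemma set_addI: "x \<in> X \<Longrightarrow> y \<in> Y \<Longrightarrow> x \<oplus>\<^bsub>M\<^esub> y \<in> X <+>\<^bsub>M\<^esub> Y"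
  unfolding set_add_def' by blast

lemma set_addE:
  assumes "z \<in> X <+>\<^bsub>M\<^esub> Y"
  obtains x y where "x \<in> X" "y \<in> Y" "z = x \<oplus>\<^bsub>M\<^esub> y"
  using assms unfolding set_add_def' by blast

lemma submodule_set_add:
  assumes X: "submodule X R M" and Y: "submodule Y R M"
  shows "submodule (X <+>\<^bsub>M\<^esub> Y) R M"
proof (rule submoduleI)
  have sub: "X \<subseteq> carrier M" "Y \<subseteq> carrier M" using X Y submoduleD(1) by auto
  then show "X <+>\<^bsub>M\<^esub> Y \<subseteq> carrier M" by (rule setadd_subset_G)
  show "\<zero>\<^bsub>M\<^esub> \<in> X <+>\<^bsub>M\<^esub> Y"
    using set_addI[OF submoduleD(2)[OF X] submoduleD(2)[OF Y]] by simp
  show "a \<oplus>\<^bsub>M\<^esub> b \<in> X <+>\<^bsub>M\<^esub> Y" if ab: "a \<in> X <+>\<^bsub>M\<^esub> Y" "b \<in> X <+>\<^bsub>M\<^esub> Y" for a b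
  proof -
    obtain x y where xy: "x \<in> X" "y \<in> Y" "a = x \<oplus>\<^bsub>M\<^esub> y" using ab(1) by (rule set_addE)
    obtain x' y' where xy': "x' \<in> X" "y' \<in> Y" "b = x' \<oplus>\<^bsub>M\<^esub> y'" using ab(2) by (rule set_addE)
    have "x \<in> carrier M" "y \<in> carrier M" "x' \<in> carrier M" "y' \<in> carrier M"
      using xy xy' sub by auto
    then have "a \<oplus>\<^bsub>M\<^esub> b = (x \<oplus>\<^bsub>M\<^esub> x') \<oplus>\<^bsub>M\<^esub> (y \<oplus>\<^bsub>M\<^esub> y')"
      unfolding xy(3) xy'(3) by (simp add: M.a_ac)
    then show ?thesis
      using set_addI[OF submoduleD(3)[OF X xy(1) xy'(1)] submoduleD(3)[OF Y xy(2) xy'(2)]] by simp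
  qed
  show "r \<odot>\<^bsub>M\<^esub> a \<in> X <+>\<^bsub>M\<^esub> Y" if r: "r \<in> carrier R" and a: "a \<in> X <+>\<^bsub>M\<^esub> Y" for r a
  proof -
    obtain x y where xy: "x \<in> X" "y \<in> Y" "a = x \<oplus>\<^bsub>M\<^esub> y" using a by (rule set_addE)
    have "x \<in> carrier M" "y \<in> carrier M"
      using xy sub by auto
    then have "r \<odot>\<^bsub>M\<^esub> a = r \<odot>\<^bsub>M\<^esub> x \<oplus>\<^bsub>M\<^esub> r \<odot>\<^bsub>M\<^esub> y"
      unfolding xy(3) by (simp add: smult_r_distr r)
    then show ?thesis
      using set_addI[OF submoduleD(4)[OF X r xy(1)] submoduleD(4)[OF Y r xy(2)]] by simp
  qed
qed

lemma set_add_upper: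
  assumes X: "submodule X R M" and Y: "submodule Y R M"
  shows "X \<subseteq> X <+>\<^bsub>M\<^esub> Y" "Y \<subseteq> X <+>\<^bsub>M\<^esub> Y"
proof -
  show "X \<subseteq> X <+>\<^bsub>M\<^esub> Y"
    using set_addI[OF _ submoduleD(2)[OF Y], of _ X] submoduleD(1)[OF X] by (auto simp: subset_iff)
  show "Y \<subseteq> X <+>\<^bsub>M\<^esub> Y"
    using set_addI[OF submoduleD(2)[OF X], of _ Y] submoduleD(1)[OF Y] by (auto simp: subset_iff)
qed

lemma set_add_least:
  assumes "submodule Z R M" "X \<subseteq> Z" "Y \<subseteq> Z"
  shows "X <+>\<^bsub>M\<^esub> Y \<subseteq> Z"
  using assms by (auto elim!: set_addE intro!: submoduleD(3)[of Z])

lemma nonzero_submoduleE: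
  assumes "nonzero_submodule R M X"
  obtains x where "x \<in> X" "x \<noteq> \<zero>\<^bsub>M\<^esub>"
  using assms submoduleD(2) unfolding nonzero_submodule_def by blast

section \<open>Sums of families of submodules\<close>

lemma submodule_sum_zero: "\<zero>\<^bsub>M\<^esub> \<in> submodule_sum M I L"
  unfolding submodule_sum_def by (rule CollectI, rule exI, rule exI[of _ "{}"]) simp

lemma submodule_sum_upper:
  assumes "i \<in> I" "L i \<subseteq> carrier M"
  shows "L i \<subseteq> submodule_sum M I L"
proof
  fix x assume x: "x \<in> L i"
  have "finsum M (\<lambda>_. x) {i} = x" using x assms by (subst M.finsum_insert) auto
  then show "x \<in> submodule_sum M I L"
    unfolding submodule_sum_def using x assms
    by (intro CollectI exI[of _ "\<lambda>_. x"] exI[of _ "{i}"]) auto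
qed

text \<open>Together with \<open>submodule_sum_upper\<close> this makes the sum the least submodule
  above all members. The inclusions between sums below rest on this pair rather than on explicit
  finite sums.\<close>

lemma submodule_sum_least:
  assumes "submodule Z R M" "\<And>i. i \<in> I \<Longrightarrow> L i \<subseteq> Z"
  shows "submodule_sum M I L \<subseteq> Z"
proof -
  have Z: "Z \<subseteq> carrier M" using assms(1) submoduleD(1) by auto
  have "finsum M f F \<in> Z" if "finite F" "F \<subseteq> I" "\<forall>i\<in>F. f i \<in> L i" for f F
    using that
  proof (induction F)
    case empty
    then show ?case using submoduleD(2)[OF assms(1)] by simp
  next
    case (insert i F)
    have "f \<in> F \<rightarrow> carrier M" "f i \<in> carrier M"
      using insert.prems assms(2) Z by (auto simp: subset_iff)
    then have "finsum M f (insert i F) = f i \<oplus>\<^bsub>M\<^esub> finsum M f F"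
      using insert.hyps by (simp add: M.finsum_insert)
    moreover have "f i \<in> Z" using insert.prems assms(2) by auto
    ultimately show ?case using insert submoduleD(3)[OF assms(1)] by auto
  qed
  then show ?thesis unfolding submodule_sum_def by auto
qed

lemma submodule_submodule_sum:
  assumes L: "\<And>i. i \<in> I \<Longrightarrow> submodule (L i) R M"
  shows "submodule (submodule_sum M I L) R M"
proof (rule submoduleI)
  have car: "L i \<subseteq> carrier M" if "i \<in> I" for i using L submoduleD(1) that by auto
  show "submodule_sum M I L \<subseteq> carrier M"
    by (rule submodule_sum_least[OF submodule_carrier car])
  show "\<zero>\<^bsub>M\<^esub> \<in> submodule_sum M I L" by (rule submodule_sum_zero)
  show "x \<oplus>\<^bsub>M\<^esub> y \<in> submodule_sum M I L"
    if xy: "x \<in> submodule_sum M I L" "y \<in> submodule_sum M I L" for x y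
  proof -
    obtain f F where f: "finite F" "F \<subseteq> I" "\<forall>i\<in>F. f i \<in> L i" "x = finsum M f F"
      using xy unfolding submodule_sum_def by auto
    obtain g G where g: "finite G" "G \<subseteq> I" "\<forall>i\<in>G. g i \<in> L i" "y = finsum M g G"
      using xy unfolding submodule_sum_def by auto
    \<comment> \<open>The two finite sums may run over different index sets; both are extended by
      zero to \<open>F \<union> G\<close> so that they can be added termwise.\<close>
    define f' where "f' = (\<lambda>i. if i \<in> F then f i else \<zero>\<^bsub>M\<^esub>)"
    define g' where "g' = (\<lambda>i. if i \<in> G then g i else \<zero>\<^bsub>M\<^esub>)"
    have in_L: "f' i \<in> L i" "g' i \<in> L i" if "i \<in> F \<union> G" for i
      using that f g L submoduleD(2) by (auto simp: f'_def g'_def)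
    then have pi: "f' \<in> F \<union> G \<rightarrow> carrier M" "g' \<in> F \<union> G \<rightarrow> carrier M"
      using car f(2) g(2) by (blast+)
    have "finsum M f F = finsum M f' (F \<union> G)"
      using f g car pi by (intro M.add.finprod_mono_neutral_cong) (auto simp: f'_def Pi_iff subset_iff)
    moreover have "finsum M g G = finsum M g' (F \<union> G)"
      using f g car pi by (intro M.add.finprod_mono_neutral_cong) (auto simp: g'_def Pi_iff subset_iff)
    ultimately have "x \<oplus>\<^bsub>M\<^esub> y = finsum M (\<lambda>i. f' i \<oplus>\<^bsub>M\<^esub> g' i) (F \<union> G)"
      using f g pi by (simp add: M.finsum_addf)
    moreover have "f' i \<oplus>\<^bsub>M\<^esub> g' i \<in> L i" if "i \<in> F \<union> G" for i
      using in_L[OF that] submoduleD(3)[OF L] that f(2) g(2) by blast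
    ultimately show ?thesis
      unfolding submodule_sum_def using f g
      by (intro CollectI exI[of _ "\<lambda>i. f' i \<oplus>\<^bsub>M\<^esub> g' i"] exI[of _ "F \<union> G"]) auto
  qed
  show "a \<odot>\<^bsub>M\<^esub> x \<in> submodule_sum M I L"
    if a: "a \<in> carrier R" and x: "x \<in> submodule_sum M I L" for a x
  proof -
    have dist: "a \<odot>\<^bsub>M\<^esub> finsum M f F = finsum M (\<lambda>i. a \<odot>\<^bsub>M\<^esub> f i) F"
      if "finite F" "\<forall>i\<in>F. f i \<in> carrier M" for f F
      using that
    proof (induction F)
      case empty
      then show ?case using a by (simp add: smult_zero_right)
    next
      case (insert i F)
      then have "f \<in> F \<rightarrow> carrier M" "(\<lambda>i. a \<odot>\<^bsub>M\<^esub> f i) \<in> F \<rightarrow> carrier M" "f i \<in> carrier M"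
        using a by auto
      then show ?case using insert a by (simp add: M.finsum_insert smult_r_distr)
    qed
    obtain f F where f: "finite F" "F \<subseteq> I" "\<forall>i\<in>F. f i \<in> L i" "x = finsum M f F"
      using x unfolding submodule_sum_def by auto
    have "a \<odot>\<^bsub>M\<^esub> x = finsum M (\<lambda>i. a \<odot>\<^bsub>M\<^esub> f i) F"
      unfolding f(4) using f car by (intro dist) (auto simp: subset_iff)
    moreover have "\<forall>i\<in>F. a \<odot>\<^bsub>M\<^esub> f i \<in> L i"
      using f a L submoduleD(4) by blast
    ultimately show ?thesis unfolding submodule_sum_def using f
      by (intro CollectI exI[of _ "\<lambda>i. a \<odot>\<^bsub>M\<^esub> f i"] exI[of _ "F"]) auto
  qed
qed

text \<open>Splits off one summand, which reduces arguments about a family to sums of two submodules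
  and permits induction on the index set.\<close>

lemma submodule_sum_insert:
  assumes "\<And>i. i \<in> insert k I \<Longrightarrow> submodule (L i) R M"
  shows "submodule_sum M (insert k I) L = L k <+>\<^bsub>M\<^esub> submodule_sum M I L"
proof
  have k: "submodule (L k) R M" and I: "submodule (submodule_sum M I L) R M"
    and kI: "submodule (submodule_sum M (insert k I) L) R M"
    using assms by (auto intro: submodule_submodule_sum)
  have car: "L i \<subseteq> carrier M" if "i \<in> insert k I" for i using assms[OF that] submoduleD(1) by auto
  show "submodule_sum M (insert k I) L \<subseteq> L k <+>\<^bsub>M\<^esub> submodule_sum M I L"
    using set_add_upper[OF k I] submodule_sum_upper[of _ I L] car
    by (intro submodule_sum_least submodule_set_add k I) blast
  show "L k <+>\<^bsub>M\<^esub> submodule_sum M I L \<subseteq> submodule_sum M (insert k I) L"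
    using submodule_sum_upper[of _ "insert k I" L] car
    by (intro set_add_least kI submodule_sum_least) auto
qed

lemma submodule_sum_cong:
  "(\<And>i. i \<in> I \<Longrightarrow> L i = L' i) \<Longrightarrow> submodule_sum M I L = submodule_sum M I L'"
  unfolding submodule_sum_def by (rule Collect_cong) (simp add: subset_iff cong: conj_cong)

lemma submodule_sum_mono:
  assumes "\<And>i. i \<in> I \<Longrightarrow> submodule (L' i) R M" "\<And>i. i \<in> J \<Longrightarrow> submodule (L i) R M"
    and "J \<subseteq> I" "\<And>i. i \<in> J \<Longrightarrow> L i \<subseteq> L' i"
  shows "submodule_sum M J L \<subseteq> submodule_sum M I L'"
proof (rule submodule_sum_least)
  show "submodule (submodule_sum M I L') R M" using assms submodule_submodule_sum by blast
  show "L i \<subseteq> submodule_sum M I L'" if "i \<in> J" for i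
    using assms that submodule_sum_upper[of i I L'] submoduleD(1)[of "L' i"] by blast
qed

text \<open>Repeated summands do not enlarge a sum, so \<open>g\<close> is merely surjective here;
  directness, in the next lemma, calls for a bijection.\<close>

lemma submodule_sum_reindex:
  assumes "\<And>i. i \<in> I \<Longrightarrow> submodule (L i) R M" "g ` J = I"
  shows "submodule_sum M J (\<lambda>j. L (g j)) = submodule_sum M I L"
proof
  have car: "L i \<subseteq> carrier M" if "i \<in> I" for i using assms(1)[OF that] submoduleD(1) by auto
  have s: "submodule (submodule_sum M J (\<lambda>j. L (g j))) R M"
    using assms by (intro submodule_submodule_sum) auto
  show "submodule_sum M J (\<lambda>j. L (g j)) \<subseteq> submodule_sum M I L"
    using assms car submodule_sum_upper[of _ I L]
    by (intro submodule_sum_least submodule_submodule_sum) blast+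
  have "L (g j) \<subseteq> submodule_sum M J (\<lambda>j. L (g j))" if "j \<in> J" for j
    using submodule_sum_upper[of j J "\<lambda>j. L (g j)"] assms(2) car[of "g j"] that by auto
  then show "submodule_sum M I L \<subseteq> submodule_sum M J (\<lambda>j. L (g j))"
    using assms s by (intro submodule_sum_least) auto
qed

section \<open>Direct sums\<close>

lemma direct_sum_reindex:
  assumes "\<And>i. i \<in> I \<Longrightarrow> submodule (L i) R M" "bij_betw g J I" "direct_sum M I L"
  shows "direct_sum M J (\<lambda>j. L (g j))"
  unfolding direct_sum_def
proof
  fix j assume j: "j \<in> J"
  have "g ` (J - {j}) = I - {g j}"
    using assms(2) j by (auto simp: bij_betw_def inj_on_def)
  then have "submodule_sum M (J - {j}) (\<lambda>j. L (g j)) = submodule_sum M (I - {g j}) L"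
    using assms(1) by (intro submodule_sum_reindex) auto
  moreover have "g j \<in> I" using assms(2) j by (auto simp: bij_betw_def)
  ultimately show "L (g j) \<inter> submodule_sum M (J - {j}) (\<lambda>j. L (g j)) = {\<zero>\<^bsub>M\<^esub>}"
    using assms(3) by (simp add: direct_sum_def)
qed

text \<open>For an old index \<open>j\<close>, let \<open>x \<in> L j\<close> equal
  \<open>l + s\<close> with \<open>l \<in> L k\<close> and \<open>s\<close> in the sum of the other
  old members. Then \<open>l = x - s\<close> lies in \<open>L k\<close> and in the old sum, so
  \<open>l = 0\<close>, and directness of the old family gives \<open>x = 0\<close>.\<close>

lemma direct_sum_insert:
  assumes L: "\<And>i. i \<in> I \<Longrightarrow> submodule (L i) R M" and X: "submodule (L k) R M"
    and "direct_sum M I L" "k \<notin> I" and int: "L k \<inter> submodule_sum M I L = {\<zero>\<^bsub>M\<^esub>}"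
  shows "direct_sum M (insert k I) L"
  unfolding direct_sum_def
proof
  have car: "L i \<subseteq> carrier M" if "i \<in> insert k I" for i
    using that L X submoduleD(1) by auto
  fix j assume j: "j \<in> insert k I"
  show "L j \<inter> submodule_sum M (insert k I - {j}) L = {\<zero>\<^bsub>M\<^esub>}"
  proof (cases "j = k")
    case True
    then show ?thesis using assms by simp
  next
    case False
    then have j: "j \<in> I" using j by auto
    have eq: "insert k I - {j} = insert k (I - {j})" using False by auto
    have sI: "submodule (submodule_sum M I L) R M" using L by (rule submodule_submodule_sum)
    have "x = \<zero>\<^bsub>M\<^esub>" if x: "x \<in> L j" and xs: "x \<in> submodule_sum M (insert k I - {j}) L" for x
    proof -
      have "x \<in> L k <+>\<^bsub>M\<^esub> submodule_sum M (I - {j}) L"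
        using xs L X unfolding eq by (subst (asm) submodule_sum_insert) auto
      then obtain l s where ls: "l \<in> L k" "s \<in> submodule_sum M (I - {j}) L" "x = l \<oplus>\<^bsub>M\<^esub> s"
        by (rule set_addE)
      have "s \<in> submodule_sum M I L"
        using ls(2) submodule_sum_mono[of I L "I - {j}" L] L by auto
      moreover have "x \<in> submodule_sum M I L" using submodule_sum_upper[of j I L] j car x by auto
      ultimately have "x \<ominus>\<^bsub>M\<^esub> s \<in> submodule_sum M I L" using submoduleD(6)[OF sI] by auto
      moreover have c: "l \<in> carrier M" "s \<in> carrier M"
        using ls car \<open>s \<in> submodule_sum M I L\<close> submoduleD(1)[OF sI] by auto
      moreover have "x \<ominus>\<^bsub>M\<^esub> s = l"
        unfolding ls(3) a_minus_def using c by (simp add: M.a_assoc M.r_neg)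
      ultimately have "l = \<zero>\<^bsub>M\<^esub>" using ls(1) int by auto
      then have "x \<in> submodule_sum M (I - {j}) L" using ls c by simp
      then show ?thesis using x assms(3) j by (auto simp: direct_sum_def)
    qed
    moreover have "\<zero>\<^bsub>M\<^esub> \<in> L j" using L j submoduleD(2) by auto
    ultimately show ?thesis using submodule_sum_zero by auto
  qed
qed

end

subsection \<open>Meet-irreducible submodules\<close>

text \<open>Uniformity of \<open>M/A\<close> stated inside \<open>M\<close>: submodules strictly
  above \<open>A\<close> correspond to nonzero submodules of \<open>M/A\<close>, and
  \<open>A \<noteq> carrier M\<close> says that \<open>M/A\<close> is nonzero. The counting argument
  for the uniform dimension can thus stay within one module.\<close>

definition meet_irreducible ::
    "('r, 's) ring_scheme \<Rightarrow> ('r, 'm, 'x) module_scheme \<Rightarrow> 'm set \<Rightarrow> bool"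
  where "meet_irreducible R M A \<longleftrightarrow>
    submodule A R M \<and> A \<noteq> carrier M \<and>
    (\<forall>X Y. submodule X R M \<and> submodule Y R M \<and> A \<subset> X \<and> A \<subset> Y \<longrightarrow> X \<inter> Y \<noteq> A)"

context left_module
begin

section \<open>Submodules regarded as modules\<close>

lemma submodule_left_module:
  assumes "submodule U R M"
  shows "left_module R (M\<lparr>carrier := U\<rparr>)"
proof -
  have sub: "x \<in> carrier M" if "x \<in> U" for x using submoduleD(1)[OF assms] that by auto
  have ag: "abelian_group (M\<lparr>carrier := U\<rparr>)"
  proof (rule abelian_groupI)
    show "\<exists>y\<in>carrier (M\<lparr>carrier := U\<rparr>). y \<oplus>\<^bsub>M\<lparr>carrier := U\<rparr>\<^esub> x = \<zero>\<^bsub>M\<lparr>carrier := U\<rparr>\<^esub>"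
      if "x \<in> carrier (M\<lparr>carrier := U\<rparr>)" for x
      using that sub submoduleD(5)[OF assms]
      by (intro bexI[of _ "\<ominus>\<^bsub>M\<^esub> x"]) (auto simp: M.l_neg)
  qed (use sub submoduleD(2,3)[OF assms] in \<open>auto simp: M.a_ac\<close>)
  show ?thesis
    by (intro left_module.intro left_module_axioms.intro R.ring_axioms ag)
       (use sub submoduleD(4)[OF assms] in \<open>auto simp: smult_l_distr smult_r_distr smult_assoc1\<close>)
qed

lemma submodule_update_iff:
  assumes U: "submodule U R M"
  shows "submodule X R (M\<lparr>carrier := U\<rparr>) \<longleftrightarrow> submodule X R M \<and> X \<subseteq> U"
proof -
  interpret U: left_module R "M\<lparr>carrier := U\<rparr>" using U by (rule submodule_left_module)
  show ?thesis
  proof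
    assume X: "submodule X R (M\<lparr>carrier := U\<rparr>)"
    show "submodule X R M \<and> X \<subseteq> U"
      using U.submoduleD(1-4)[OF X] submoduleD(1)[OF U] by (auto intro!: submoduleI)
  next
    assume X: "submodule X R M \<and> X \<subseteq> U"
    then show "submodule X R (M\<lparr>carrier := U\<rparr>)"
      using submoduleD(2-4)[of X] by (intro U.submoduleI) auto
  qed
qed

lemma nonzero_submodule_update_iff:
  "submodule U R M \<Longrightarrow>
    nonzero_submodule R (M\<lparr>carrier := U\<rparr>) X \<longleftrightarrow> nonzero_submodule R M X \<and> X \<subseteq> U"
  unfolding nonzero_submodule_def by (subst submodule_update_iff) auto

lemma uniform_module_iff:
  "uniform_module R M \<longleftrightarrow> carrier M \<noteq> {\<zero>\<^bsub>M\<^esub>} \<and>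
    (\<forall>X Y. nonzero_submodule R M X \<and> nonzero_submodule R M Y \<longrightarrow> X \<inter> Y \<noteq> {\<zero>\<^bsub>M\<^esub>})"
proof -
  have "nonzero_submodule R M X \<Longrightarrow> submodule X R M" for X
    by (simp add: nonzero_submodule_def)
  then show ?thesis
    unfolding uniform_module_def essential_submodule_def by blast
qed

text \<open>Restates uniformity of \<open>U\<close> through submodules of \<open>M\<close> contained
  in \<open>U\<close>, so that later arguments avoid the module
  \<open>M\<lparr>carrier := U\<rparr>\<close>.\<close>

lemma uniform_submodule_iff:
  "uniform_submodule R M U \<longleftrightarrow> nonzero_submodule R M U \<and>
    (\<forall>X Y. nonzero_submodule R M X \<and> nonzero_submodule R M Y \<and> X \<subseteq> U \<and> Y \<subseteq> U \<longrightarrow>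
      X \<inter> Y \<noteq> {\<zero>\<^bsub>M\<^esub>})"
proof (cases "submodule U R M")
  case True
  then interpret U: left_module R "M\<lparr>carrier := U\<rparr>" by (rule submodule_left_module)
  show ?thesis
    unfolding uniform_submodule_def U.uniform_module_iff nonzero_submodule_update_iff[OF True]
      nonzero_submodule_def[of R M U]
    using True by auto
qed (simp add: uniform_submodule_def nonzero_submodule_def)

text \<open>Zorn's lemma for the submodules that contain \<open>B\<close> and meet \<open>A\<close>
  in zero; the union of a nonempty chain of such submodules is again one.\<close>

lemma complement_exists:
  assumes A: "submodule A R M" and B: "submodule B R M" and AB: "A \<inter> B = {\<zero>\<^bsub>M\<^esub>}"
  obtains C where "complement_of R M A C" "B \<subseteq> C"
proof -
  define \<A> where "\<A> = {D. submodule D R M \<and> A \<inter> D = {\<zero>\<^bsub>M\<^esub>} \<and> B \<subseteq> D}"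
  have "\<exists>C\<in>\<A>. \<forall>X\<in>\<A>. C \<subseteq> X \<longrightarrow> X = C"
  proof (rule subset_Zorn_nonempty)
    show "\<A> \<noteq> {}" using assms by (auto simp: \<A>_def)
    fix \<C> assume ne: "\<C> \<noteq> {}" and "subset.chain \<A> \<C>"
    then have sub: "\<C> \<subseteq> \<A>" and chain: "\<And>X Y. X \<in> \<C> \<Longrightarrow> Y \<in> \<C> \<Longrightarrow> X \<subseteq> Y \<or> Y \<subseteq> X"
      by (auto simp: subset_chain_def)
    have subm: "submodule D R M" if "D \<in> \<C>" for D using that sub by (auto simp: \<A>_def)
    have "submodule (\<Union>\<C>) R M"
    proof (rule submoduleI)
      show "\<Union>\<C> \<subseteq> carrier M" using subm submoduleD(1) by blast
      show "\<zero>\<^bsub>M\<^esub> \<in> \<Union>\<C>" using ne subm submoduleD(2) by blast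
      show "x \<oplus>\<^bsub>M\<^esub> y \<in> \<Union>\<C>" if x: "x \<in> \<Union>\<C>" and y: "y \<in> \<Union>\<C>" for x y
      proof -
        obtain X Y where "X \<in> \<C>" "x \<in> X" "Y \<in> \<C>" "y \<in> Y" using x y by blast
        then obtain Z where "Z \<in> \<C>" "x \<in> Z" "y \<in> Z" using chain by blast
        then show ?thesis using submoduleD(3)[OF subm] by blast
      qed
      show "a \<odot>\<^bsub>M\<^esub> x \<in> \<Union>\<C>" if "a \<in> carrier R" and x: "x \<in> \<Union>\<C>" for a x
        using that submoduleD(4)[OF subm] by blast
    qed
    then show "\<Union>\<C> \<in> \<A>" using ne sub unfolding \<A>_def by blast
  qed
  then obtain C where C: "C \<in> \<A>" and max: "\<forall>X\<in>\<A>. C \<subseteq> X \<longrightarrow> X = C" by blast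
  \<comment> \<open>Any \<open>D\<close> above \<open>C\<close> contains \<open>B\<close> too, so
    maximality within \<open>\<A>\<close> is maximality among all submodules meeting
    \<open>A\<close> in zero.\<close>
  have "D = C" if "submodule D R M" "A \<inter> D = {\<zero>\<^bsub>M\<^esub>}" "C \<subseteq> D" for D
    using that C max[rule_format, of D] by (auto simp: \<A>_def)
  then have "complement_of R M A C" using C by (simp add: complement_of_def \<A>_def)
  moreover have "B \<subseteq> C" using C by (simp add: \<A>_def)
  ultimately show ?thesis by (rule that)
qed

text \<open>By maximality every submodule strictly above \<open>C\<close> meets \<open>U\<close> in
  a nonzero submodule. If \<open>X \<inter> Y = C\<close> with both strictly larger, then
  \<open>U \<inter> X\<close> and \<open>U \<inter> Y\<close> would be nonzero with zero
  intersection, against uniformity of \<open>U\<close>.\<close>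

lemma complement_of_uniform_meet_irreducible:
  assumes U: "uniform_submodule R M U" and C: "complement_of R M U C"
  shows "meet_irreducible R M C"
proof -
  have sU: "submodule U R M" and U0: "U \<noteq> {\<zero>\<^bsub>M\<^esub>}"
    and uni: "\<And>X Y. nonzero_submodule R M X \<Longrightarrow> nonzero_submodule R M Y \<Longrightarrow> X \<subseteq> U \<Longrightarrow> Y \<subseteq> U \<Longrightarrow>
      X \<inter> Y \<noteq> {\<zero>\<^bsub>M\<^esub>}"
    using U unfolding uniform_submodule_iff nonzero_submodule_def by blast+
  have sC: "submodule C R M" and UC: "U \<inter> C = {\<zero>\<^bsub>M\<^esub>}"
    and max: "\<And>D. submodule D R M \<Longrightarrow> U \<inter> D = {\<zero>\<^bsub>M\<^esub>} \<Longrightarrow> C \<subseteq> D \<Longrightarrow> D = C"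
    using C unfolding complement_of_def by blast+
  have meet: "nonzero_submodule R M (U \<inter> X)" if "submodule X R M" "C \<subset> X" for X
    using max[of X] that submodule_Int[OF sU] unfolding nonzero_submodule_def by blast
  have "X \<inter> Y \<noteq> C" if "submodule X R M" "submodule Y R M" "C \<subset> X" "C \<subset> Y" for X Y
  proof
    assume "X \<inter> Y = C"
    then have "(U \<inter> X) \<inter> (U \<inter> Y) = {\<zero>\<^bsub>M\<^esub>}" using UC by blast
    then show False using uni[OF meet meet, of X Y] that by blast
  qed
  moreover have "C \<noteq> carrier M" using UC U0 submoduleD(1)[OF sU] by blast
  ultimately show ?thesis using sC unfolding meet_irreducible_def by blast
qed

text \<open>The images of \<open>X\<close> and \<open>Y\<close> in \<open>M/A\<close> share a
  nonzero element. Indeed \<open>X + A\<close> and \<open>Y + A\<close> lie strictly above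
  \<open>A\<close>, so they have a common element \<open>z = x + a = y + b\<close> outside
  \<open>A\<close>, and \<open>x - y = b - a\<close> lies in \<open>A\<close>.\<close>

lemma meet_irreducible_sums_meet:
  assumes A: "meet_irreducible R M A"
    and X: "nonzero_submodule R M X" "X \<inter> A = {\<zero>\<^bsub>M\<^esub>}"
    and Y: "nonzero_submodule R M Y" "Y \<inter> A = {\<zero>\<^bsub>M\<^esub>}"
  obtains x y where "x \<in> X" "y \<in> Y" "x \<ominus>\<^bsub>M\<^esub> y \<in> A" "x \<notin> A"
proof -
  have sA: "submodule A R M" using A unfolding meet_irreducible_def by blast
  have sX: "submodule X R M" and sY: "submodule Y R M"
    using X Y unfolding nonzero_submodule_def by auto
  have strict: "A \<subset> Z <+>\<^bsub>M\<^esub> A" if Z: "nonzero_submodule R M Z" "Z \<inter> A = {\<zero>\<^bsub>M\<^esub>}" for Z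
  proof -
    have "submodule Z R M" using Z unfolding nonzero_submodule_def by auto
    moreover obtain z where "z \<in> Z" "z \<noteq> \<zero>\<^bsub>M\<^esub>" using Z(1) by (rule nonzero_submoduleE)
    then have "\<not> Z \<subseteq> A" using Z(2) by blast
    ultimately show ?thesis using set_add_upper[OF _ sA, of Z] by blast
  qed
  have "(X <+>\<^bsub>M\<^esub> A) \<inter> (Y <+>\<^bsub>M\<^esub> A) \<noteq> A"
    using A strict[OF X] strict[OF Y] submodule_set_add[OF sX sA] submodule_set_add[OF sY sA]
    unfolding meet_irreducible_def by blast
  then obtain z where z: "z \<in> X <+>\<^bsub>M\<^esub> A" "z \<in> Y <+>\<^bsub>M\<^esub> A" "z \<notin> A"
    using strict[OF X] strict[OF Y] by blast
  obtain x a where xa: "x \<in> X" "a \<in> A" "z = x \<oplus>\<^bsub>M\<^esub> a" using z(1) by (rule set_addE)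
  obtain y b where yb: "y \<in> Y" "b \<in> A" "z = y \<oplus>\<^bsub>M\<^esub> b" using z(2) by (rule set_addE)
  have car: "x \<in> carrier M" "a \<in> carrier M" "y \<in> carrier M" "b \<in> carrier M"
    using xa yb submoduleD(1)[OF sX] submoduleD(1)[OF sY] submoduleD(1)[OF sA] by auto
  have "x = z \<ominus>\<^bsub>M\<^esub> a" unfolding xa(3) using car by (simp add: add_minus_cancel)
  also have "\<dots> = y \<oplus>\<^bsub>M\<^esub> (b \<ominus>\<^bsub>M\<^esub> a)" unfolding yb(3) a_minus_def using car by (simp add: M.a_assoc)
  finally have "x \<ominus>\<^bsub>M\<^esub> y = b \<ominus>\<^bsub>M\<^esub> a"
    using add_minus_cancel(1)[of y "b \<ominus>\<^bsub>M\<^esub> a"] car by simp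
  then have "x \<ominus>\<^bsub>M\<^esub> y \<in> A" using submoduleD(6)[OF sA yb(2) xa(2)] by simp
  moreover have "x \<notin> A" using z(3) xa submoduleD(3)[OF sA] by blast
  ultimately show ?thesis using that xa(1) yb(1) by blast
qed

text \<open>\<open>K\<close> embeds in \<open>M/A\<close>, which is uniform. Concretely, for nonzero
  \<open>X\<close> and \<open>Y\<close> inside \<open>K\<close> the elements \<open>x\<close> and
  \<open>y\<close> of \<open>meet_irreducible_sums_meet\<close> satisfy
  \<open>x - y \<in> K \<inter> A = 0\<close>, so \<open>x = y\<close> is a nonzero common
  element.\<close>

lemma uniform_if_disjoint_meet_irreducible:
  assumes "meet_irreducible R M A" "nonzero_submodule R M K" "K \<inter> A = {\<zero>\<^bsub>M\<^esub>}"
  shows "uniform_submodule R M K"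
  unfolding uniform_submodule_iff
proof (intro conjI allI impI)
  fix X Y
  assume "nonzero_submodule R M X \<and> nonzero_submodule R M Y \<and> X \<subseteq> K \<and> Y \<subseteq> K"
  then have X: "nonzero_submodule R M X" "X \<subseteq> K" and Y: "nonzero_submodule R M Y" "Y \<subseteq> K" by auto
  have sK: "submodule K R M" using assms(2) unfolding nonzero_submodule_def by auto
  have sA: "submodule A R M" using assms(1) unfolding meet_irreducible_def by auto
  have XA: "X \<inter> A = {\<zero>\<^bsub>M\<^esub>}" and YA: "Y \<inter> A = {\<zero>\<^bsub>M\<^esub>}"
    using X Y assms(3) submoduleD(2)[of X] submoduleD(2)[of Y] unfolding nonzero_submodule_def by blast+
  obtain x y where xy: "x \<in> X" "y \<in> Y" "x \<ominus>\<^bsub>M\<^esub> y \<in> A" "x \<notin> A"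
    using meet_irreducible_sums_meet[OF assms(1) X(1) XA Y(1) YA] by blast
  have car: "x \<in> carrier M" "y \<in> carrier M"
    using xy X(2) Y(2) submoduleD(1)[OF sK] by auto
  have "x \<in> K" "y \<in> K" using xy X(2) Y(2) by auto
  then have "x \<ominus>\<^bsub>M\<^esub> y \<in> K" by (rule submoduleD(6)[OF sK])
  then have "x \<ominus>\<^bsub>M\<^esub> y = \<zero>\<^bsub>M\<^esub>" using xy(3) assms(3) by blast
  then have "x = y" using car by (simp add: minus_eq_zero_iff)
  moreover have "x \<noteq> \<zero>\<^bsub>M\<^esub>" using xy(4) submoduleD(2)[OF sA] by auto
  ultimately show "X \<inter> Y \<noteq> {\<zero>\<^bsub>M\<^esub>}" using xy by blast
qed (fact assms(2))

subsection \<open>Uniform dimension\<close>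

lemma direct_sum_mono:
  assumes "\<And>i. i \<in> I \<Longrightarrow> submodule (L i) R M" "\<And>i. i \<in> I \<Longrightarrow> submodule (L' i) R M"
    and "\<And>i. i \<in> I \<Longrightarrow> L' i \<subseteq> L i" "direct_sum M I L"
  shows "direct_sum M I L'"
  unfolding direct_sum_def
proof
  fix i assume i: "i \<in> I"
  have "submodule_sum M (I - {i}) L' \<subseteq> submodule_sum M (I - {i}) L"
    using assms by (intro submodule_sum_mono) auto
  then have "L' i \<inter> submodule_sum M (I - {i}) L' \<subseteq> {\<zero>\<^bsub>M\<^esub>}"
    using assms(3)[OF i] assms(4) i unfolding direct_sum_def by blast
  then show "L' i \<inter> submodule_sum M (I - {i}) L' = {\<zero>\<^bsub>M\<^esub>}"
    using submodule_sum_zero[of "I - {i}" L'] submoduleD(2)[OF assms(2)[OF i]] by blast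
qed

text \<open>Moves a direct sum into \<open>A\<close> at the price of the summand \<open>V p\<close>.
  If \<open>w = x + y\<close>, with \<open>x \<in> V p\<close> and \<open>y \<in> V t\<close>, lies
  in \<open>A\<close> and in the sum of all \<open>V j\<close> with \<open>j \<noteq> t\<close>,
  then so does \<open>y = w - x\<close> in that sum, hence \<open>y = 0\<close> by directness and
  \<open>w = x \<in> V p \<inter> A = 0\<close>.\<close>

lemma direct_sum_exchange:
  assumes V: "\<And>t. t \<in> T \<Longrightarrow> submodule (V t) R M" and dir: "direct_sum M T V" and p: "p \<in> T"
    and A: "submodule A R M" and pA: "V p \<inter> A = {\<zero>\<^bsub>M\<^esub>}"
  shows "direct_sum M (T - {p}) (\<lambda>t. (V p <+>\<^bsub>M\<^esub> V t) \<inter> A)"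
  unfolding direct_sum_def
proof
  define W where "W = (\<lambda>t. (V p <+>\<^bsub>M\<^esub> V t) \<inter> A)"
  have sW: "submodule (W t) R M" if "t \<in> T" for t
    unfolding W_def using V that p A by (intro submodule_Int submodule_set_add) auto
  fix t assume t: "t \<in> T - {p}"
  define S where "S = submodule_sum M (T - {p} - {t}) V"
  have sS: "submodule S R M" unfolding S_def using V by (intro submodule_submodule_sum) auto
  have sT: "submodule (submodule_sum M (T - {t}) V) R M"
    using V by (intro submodule_submodule_sum) auto
  have insert: "insert p (T - {p} - {t}) = T - {t}" using t p by auto
  have ST: "V p <+>\<^bsub>M\<^esub> S = submodule_sum M (T - {t}) V"
    unfolding S_def insert[symmetric] by (rule submodule_sum_insert[symmetric]) (use V p in auto)
  have "submodule_sum M (T - {p} - {t}) W \<subseteq> V p <+>\<^bsub>M\<^esub> S"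
  proof (rule submodule_sum_least)
    show "submodule (V p <+>\<^bsub>M\<^esub> S) R M" by (intro submodule_set_add V p sS)
    fix j assume j: "j \<in> T - {p} - {t}"
    have "V j \<subseteq> S" unfolding S_def
      using j submoduleD(1)[OF V[of j]] by (intro submodule_sum_upper) auto
    then have "V p <+>\<^bsub>M\<^esub> V j \<subseteq> V p <+>\<^bsub>M\<^esub> S"
      using set_add_upper[OF V[OF p] sS] submodule_set_add[OF V[OF p] sS]
      by (intro set_add_least) auto
    then show "W j \<subseteq> V p <+>\<^bsub>M\<^esub> S" unfolding W_def by auto
  qed
  moreover have "w = \<zero>\<^bsub>M\<^esub>" if w: "w \<in> W t" and wS: "w \<in> V p <+>\<^bsub>M\<^esub> S" for w
  proof -
    have "w \<in> V p <+>\<^bsub>M\<^esub> V t" "w \<in> A" using w by (auto simp: W_def)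
    then obtain x y where xy: "x \<in> V p" "y \<in> V t" "w = x \<oplus>\<^bsub>M\<^esub> y" by (auto elim: set_addE)
    have car: "x \<in> carrier M" "y \<in> carrier M"
      using xy submoduleD(1)[OF V] p t by auto
    have "x \<in> V p <+>\<^bsub>M\<^esub> S" using set_add_upper[OF V[OF p] sS] xy by auto
    with wS have "w \<ominus>\<^bsub>M\<^esub> x \<in> submodule_sum M (T - {t}) V"
      unfolding ST by (rule submoduleD(6)[OF sT])
    moreover have "w \<ominus>\<^bsub>M\<^esub> x = y"
      unfolding xy(3) using car by (simp add: add_minus_cancel)
    ultimately have "y \<in> V t \<inter> submodule_sum M (T - {t}) V" using xy by auto
    then have "y = \<zero>\<^bsub>M\<^esub>" using dir t unfolding direct_sum_def by blast
    then have "w = x" using xy car by simp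
    then show ?thesis using xy(1) pA \<open>w \<in> A\<close> by auto
  qed
  ultimately have "W t \<inter> submodule_sum M (T - {p} - {t}) W \<subseteq> {\<zero>\<^bsub>M\<^esub>}" by blast
  then show "W t \<inter> submodule_sum M (T - {p} - {t}) W = {\<zero>\<^bsub>M\<^esub>}"
    using submodule_sum_zero[of "T - {p} - {t}" W] submoduleD(2)[OF sW, of t] t by blast
qed

text \<open>
  Induction on the number of meet-irreducible submodules: replacing \<open>B\<close> by \<open>B \<inter> A k\<close> costs at most
  one summand, because either every \<open>V t\<close> meets \<open>A k\<close> or some \<open>V p\<close> does not, and then meet-irreducibility
  forces each \<open>V p + V t\<close> to meet \<open>A k\<close>.
\<close>

lemma card_direct_sum_le:
  assumes "finite S" "\<And>i. i \<in> S \<Longrightarrow> meet_irreducible R M (A i)"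
    and "submodule B R M" "B \<inter> (\<Inter>i\<in>S. A i) = {\<zero>\<^bsub>M\<^esub>}"
    and "finite T" "\<And>t. t \<in> T \<Longrightarrow> nonzero_submodule R M (V t)" "\<And>t. t \<in> T \<Longrightarrow> V t \<subseteq> B"
    and "direct_sum M T V"
  shows "card T \<le> card S"
  using assms
proof (induction S arbitrary: B T V)
  case empty
  \<comment> \<open>The intersection over no indices is the whole type, so the hypothesis says that
    \<open>B\<close> is zero and leaves no room for a nonzero \<open>V t\<close>.\<close>
  have "T = {}"
  proof (rule ccontr)
    assume "T \<noteq> {}"
    then obtain t where "t \<in> T" by blast
    then obtain x where "x \<in> V t" "x \<noteq> \<zero>\<^bsub>M\<^esub>" using empty.prems(5) nonzero_submoduleE by blast
    then show False using empty.prems(3,6) \<open>t \<in> T\<close> by auto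
  qed
  then show ?case by simp
next
  case (insert k S)
  have sV: "submodule (V t) R M" if "t \<in> T" for t
    using insert.prems(5)[OF that] unfolding nonzero_submodule_def by auto
  have mk: "meet_irreducible R M (A k)" using insert.prems(1) by blast
  then have sA: "submodule (A k) R M" unfolding meet_irreducible_def by blast
  \<comment> \<open>The submodules \<open>A i\<close> with \<open>i \<in> S\<close> meet
    \<open>B \<inter> A k\<close> in zero, so the induction hypothesis bounds every direct sum of
    nonzero submodules inside \<open>B \<inter> A k\<close> that is indexed by a subset of
    \<open>T\<close>.\<close>
  have IH: "card T' \<le> card S"
    if "T' \<subseteq> T" "\<And>t. t \<in> T' \<Longrightarrow> nonzero_submodule R M (W t)" "\<And>t. t \<in> T' \<Longrightarrow> W t \<subseteq> B \<inter> A k"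
      and "direct_sum M T' W" for T' W
    using that insert.prems finite_subset[OF that(1)] submodule_Int[OF insert.prems(2) sA]
    by (intro insert.IH[of "B \<inter> A k" T' W]) (auto simp: Int_assoc)
  show ?case
  proof (cases "\<forall>t\<in>T. V t \<inter> A k \<noteq> {\<zero>\<^bsub>M\<^esub>}")
    case True
    have "card T \<le> card S"
    proof (rule IH[of T "\<lambda>t. V t \<inter> A k"])
      show "direct_sum M T (\<lambda>t. V t \<inter> A k)"
        by (rule direct_sum_mono[OF sV submodule_Int[OF sV sA] _ insert.prems(7)]) auto
      show "nonzero_submodule R M (V t \<inter> A k)" if "t \<in> T" for t
        using that True submodule_Int[OF sV[OF that] sA] unfolding nonzero_submodule_def by simp
      show "V t \<inter> A k \<subseteq> B \<inter> A k" if "t \<in> T" for t using that insert.prems(6) by auto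
    qed auto
    then show ?thesis using insert.hyps by simp
  next
    case False
    then obtain p where p: "p \<in> T" "V p \<inter> A k = {\<zero>\<^bsub>M\<^esub>}" by blast
    have "card (T - {p}) \<le> card S"
    proof (rule IH[of "T - {p}" "\<lambda>t. (V p <+>\<^bsub>M\<^esub> V t) \<inter> A k"])
      show "direct_sum M (T - {p}) (\<lambda>t. (V p <+>\<^bsub>M\<^esub> V t) \<inter> A k)"
        by (intro direct_sum_exchange sV insert.prems(7) p sA)
      fix t assume t: "t \<in> T - {p}"
      show "(V p <+>\<^bsub>M\<^esub> V t) \<inter> A k \<subseteq> B \<inter> A k"
        using set_add_least[OF insert.prems(2)] insert.prems(6) p t by auto
      have "(V p <+>\<^bsub>M\<^esub> V t) \<inter> A k \<noteq> {\<zero>\<^bsub>M\<^esub>}"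
      proof
        \<comment> \<open>Now \<open>V t\<close> misses \<open>A k\<close> as well, so there are
          \<open>x \<in> V p\<close> and \<open>y \<in> V t\<close> with
          \<open>x \<notin> A k\<close> and \<open>x - y \<in> A k\<close>. This difference lies in
          \<open>V p + V t\<close>, hence is zero, and \<open>x = y\<close> contradicts
          directness.\<close>
        assume 0: "(V p <+>\<^bsub>M\<^esub> V t) \<inter> A k = {\<zero>\<^bsub>M\<^esub>}"
        have up: "V p \<subseteq> V p <+>\<^bsub>M\<^esub> V t" "V t \<subseteq> V p <+>\<^bsub>M\<^esub> V t" using set_add_upper sV p t by auto
        have "\<zero>\<^bsub>M\<^esub> \<in> V t" "\<zero>\<^bsub>M\<^esub> \<in> A k" using submoduleD(2) sV sA t by auto
        with up 0 have tA: "V t \<inter> A k = {\<zero>\<^bsub>M\<^esub>}" by blast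
        have "nonzero_submodule R M (V p)" "nonzero_submodule R M (V t)"
          using insert.prems(5) p(1) t by auto
        then obtain x y where xy: "x \<in> V p" "y \<in> V t" "x \<ominus>\<^bsub>M\<^esub> y \<in> A k" "x \<notin> A k"
          using meet_irreducible_sums_meet[OF mk _ p(2) _ tA] by blast
        have car: "x \<in> carrier M" "y \<in> carrier M"
          using xy submoduleD(1)[OF sV] p t by auto
        have "x \<ominus>\<^bsub>M\<^esub> y \<in> V p <+>\<^bsub>M\<^esub> V t"
          using xy up submoduleD(6)[OF submodule_set_add[OF sV sV], of p t] p t by auto
        then have "x \<ominus>\<^bsub>M\<^esub> y = \<zero>\<^bsub>M\<^esub>" using xy 0 by blast
        then have "x = y" using car by (simp add: minus_eq_zero_iff)
        moreover have "V t \<subseteq> submodule_sum M (T - {p}) V"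
          using t submoduleD(1)[OF sV] by (intro submodule_sum_upper) auto
        ultimately have "x = \<zero>\<^bsub>M\<^esub>"
          using xy insert.prems(7) p(1) unfolding direct_sum_def by blast
        then show False using xy(4) submoduleD(2)[OF sA] by auto
      qed
      then show "nonzero_submodule R M ((V p <+>\<^bsub>M\<^esub> V t) \<inter> A k)"
        using submodule_Int[OF submodule_set_add[OF sV sV] sA, of p t] p t
        unfolding nonzero_submodule_def by simp
    qed auto
    then show ?thesis using insert.hyps insert.prems(4) p(1) by (simp add: card_Diff_singleton)
  qed
qed

text \<open>By essentiality it suffices that the intersection meets the sum of the
  \<open>U i\<close> in zero. It serves twice: with complements, for the invariance of the uniform
  dimension, and with the factors \<open>N\<^sub>i'/N\<close>, for the converse part of the
  theorem.\<close>

lemma INT_eq_zero_if_essential_sum: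
  assumes "finite I" and U: "\<And>i. i \<in> I \<Longrightarrow> submodule (U i) R M"
    and A: "\<And>i. i \<in> I \<Longrightarrow> submodule (A i) R M"
    and ess: "essential_submodule R M (submodule_sum M I U)"
    and UA: "\<And>i. i \<in> I \<Longrightarrow> U i \<inter> A i = {\<zero>\<^bsub>M\<^esub>}"
    and sum: "\<And>i. i \<in> I \<Longrightarrow> submodule_sum M (I - {i}) U \<subseteq> A i"
  shows "carrier M \<inter> (\<Inter>i\<in>I. A i) = {\<zero>\<^bsub>M\<^esub>}"
proof (rule ccontr)
  assume "carrier M \<inter> (\<Inter>i\<in>I. A i) \<noteq> {\<zero>\<^bsub>M\<^esub>}"
  then have "nonzero_submodule R M (carrier M \<inter> (\<Inter>i\<in>I. A i))"
    unfolding nonzero_submodule_def using submodule_INT[OF A] by simp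
  then have ne: "submodule_sum M I U \<inter> (carrier M \<inter> (\<Inter>i\<in>I. A i)) \<noteq> {\<zero>\<^bsub>M\<^esub>}"
    using ess unfolding essential_submodule_def by blast
  \<comment> \<open>Generalised to sums over \<open>J \<subseteq> I\<close>, while \<open>x\<close>
    still lies in every \<open>A i\<close> with \<open>i \<in> I\<close>. The component at
    \<open>k\<close> lies in \<open>U k \<inter> A k\<close>, so it vanishes and \<open>k\<close>
    can be removed from the index set.\<close>
  have "x = \<zero>\<^bsub>M\<^esub>" if "finite J" "J \<subseteq> I" "x \<in> submodule_sum M J U" "\<forall>i\<in>I. x \<in> A i" for x J
    using that
  proof (induction J)
    case empty
    have "submodule_sum M {} U \<subseteq> {\<zero>\<^bsub>M\<^esub>}" by (rule submodule_sum_least[OF submodule_zero]) auto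
    then show ?case using empty by auto
  next
    case (insert k J)
    have k: "k \<in> I" and sJ: "submodule (submodule_sum M J U) R M"
      using insert.prems U by (auto intro!: submodule_submodule_sum)
    have "x \<in> U k <+>\<^bsub>M\<^esub> submodule_sum M J U"
      using insert.prems U by (subst submodule_sum_insert[symmetric]) auto
    then obtain u s where us: "u \<in> U k" "s \<in> submodule_sum M J U" "x = u \<oplus>\<^bsub>M\<^esub> s"
      by (rule set_addE)
    have car: "u \<in> carrier M" "s \<in> carrier M"
      using us submoduleD(1)[OF U[OF k]] submoduleD(1)[OF sJ] by auto
    have "submodule_sum M J U \<subseteq> submodule_sum M (I - {k}) U"
      using insert U by (intro submodule_sum_mono) auto
    then have "s \<in> A k" using us sum[OF k] by auto
    then have "x \<ominus>\<^bsub>M\<^esub> s \<in> A k" using insert.prems(3) k submoduleD(6)[OF A[OF k]] by blast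
    moreover have "x \<ominus>\<^bsub>M\<^esub> s = u"
      unfolding us(3) using car by (simp add: add_minus_cancel)
    ultimately have "u = \<zero>\<^bsub>M\<^esub>" using us UA[OF k] by auto
    then have "x \<in> submodule_sum M J U" using us car by simp
    then show ?case using insert by auto
  qed
  then have "submodule_sum M I U \<inter> (carrier M \<inter> (\<Inter>i\<in>I. A i)) \<subseteq> {\<zero>\<^bsub>M\<^esub>}"
    using assms(1) by blast
  moreover have "\<zero>\<^bsub>M\<^esub> \<in> submodule_sum M I U \<inter> (carrier M \<inter> (\<Inter>i\<in>I. A i))"
    using submodule_sum_zero A submoduleD(2) by auto
  ultimately show False using ne by blast
qed

lemma essential_if_maximal_direct_sum:
  fixes U :: "nat \<Rightarrow> 'c set"
  assumes fin: "finite I" and U: "\<And>i. i \<in> I \<Longrightarrow> nonzero_submodule R M (U i)" and dir: "direct_sum M I U"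
    and max: "\<And>T (V :: nat \<Rightarrow> 'c set). finite T \<Longrightarrow> (\<And>t. t \<in> T \<Longrightarrow> nonzero_submodule R M (V t)) \<Longrightarrow>
      direct_sum M T V \<Longrightarrow> card T \<le> card I"
  shows "essential_submodule R M (submodule_sum M I U)"
proof -
  have sU: "submodule (U i) R M" if "i \<in> I" for i
    using U[OF that] by (simp add: nonzero_submodule_def)
  have "submodule_sum M I U \<inter> L \<noteq> {\<zero>\<^bsub>M\<^esub>}" if L: "nonzero_submodule R M L" for L
  proof
    assume int: "submodule_sum M I U \<inter> L = {\<zero>\<^bsub>M\<^esub>}"
    obtain k where k: "k \<notin> I" using fin ex_new_if_finite infinite_UNIV_nat by blast
    define V where "V = U(k := L)"
    have eq: "V i = U i" if "i \<in> I" for i using that k by (auto simp: V_def)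
    have sums: "submodule_sum M I V = submodule_sum M I U"
      by (rule submodule_sum_cong) (rule eq)
    have "submodule_sum M (I - {i}) V = submodule_sum M (I - {i}) U" for i
      by (rule submodule_sum_cong) (simp add: eq)
    then have "direct_sum M I V" using dir by (simp add: direct_sum_def eq)
    then have "direct_sum M (insert k I) V"
      using sU L k int sums
      by (intro direct_sum_insert) (auto simp: eq nonzero_submodule_def V_def)
    then have "card (insert k I) \<le> card I"
      using fin U L by (intro max[of _ V]) (auto simp: V_def)
    then show False using fin k by simp
  qed
  moreover have "submodule (submodule_sum M I U) R M"
    using sU by (rule submodule_submodule_sum)
  ultimately show ?thesis by (simp add: essential_submodule_def)
qed

text \<open>Each \<open>U i\<close> has a complement above the sum of the other summands. These
  complements are meet-irreducible and intersect in zero, so \<open>card_direct_sum_le\<close>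
  applies.\<close>

lemma card_le_if_essential_sum:
  assumes fin: "finite I" and U: "\<And>i. i \<in> I \<Longrightarrow> uniform_submodule R M (U i)"
    and dir: "direct_sum M I U" and ess: "essential_submodule R M (submodule_sum M I U)"
    and T: "finite T" "\<And>t. t \<in> T \<Longrightarrow> nonzero_submodule R M (V t)" "direct_sum M T V"
  shows "card T \<le> card I"
proof -
  have sU: "submodule (U i) R M" if "i \<in> I" for i
    using U[OF that] by (simp add: uniform_submodule_def)
  have "\<exists>C. complement_of R M (U i) C \<and> submodule_sum M (I - {i}) U \<subseteq> C" if i: "i \<in> I" for i
  proof -
    have "submodule (submodule_sum M (I - {i}) U) R M"
      using sU by (intro submodule_submodule_sum) auto
    moreover have "U i \<inter> submodule_sum M (I - {i}) U = {\<zero>\<^bsub>M\<^esub>}"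
      using dir i unfolding direct_sum_def by blast
    ultimately show ?thesis using complement_exists[OF sU[OF i]] by metis
  qed
  then obtain C where C: "complement_of R M (U i) (C i)" "submodule_sum M (I - {i}) U \<subseteq> C i"
    if "i \<in> I" for i by metis
  have irr: "meet_irreducible R M (C i)" if "i \<in> I" for i
    using complement_of_uniform_meet_irreducible[OF U C(1)] that by blast
  have "carrier M \<inter> (\<Inter>i\<in>I. C i) = {\<zero>\<^bsub>M\<^esub>}"
    using C fin sU ess
    by (intro INT_eq_zero_if_essential_sum[of I U C]) (auto simp: complement_of_def)
  moreover have "V t \<subseteq> carrier M" if "t \<in> T" for t
    using T(2)[OF that] submoduleD(1) by (auto simp: nonzero_submodule_def)
  ultimately show ?thesis
    using fin irr T by (intro card_direct_sum_le[of I C "carrier M" T V] submodule_carrier) auto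
qed

text \<open>Invariance of the uniform dimension: two essential direct sums of uniform submodules
  bound each other's number of terms. This justifies the definite description in
  \<open>udim\<close>.\<close>

lemma udim_eq_card:
  fixes U :: "nat \<Rightarrow> 'c set"
  assumes fin: "finite I" and U: "\<And>i. i \<in> I \<Longrightarrow> uniform_submodule R M (U i)"
    and dir: "direct_sum M I U" and ess: "essential_submodule R M (submodule_sum M I U)"
  shows "udim R M = card I"
  unfolding udim_def
proof (rule the_equality)
  have sU: "submodule (U i) R M" if "i \<in> I" for i
    using U[OF that] by (simp add: uniform_submodule_def)
  \<comment> \<open>\<open>udim\<close> speaks of families indexed by an initial segment starting at
    \<open>1\<close>, so \<open>I\<close> is renumbered.\<close>
  obtain g where g: "bij_betw g {1..card I} I"
    using ex_bij_betw_nat_finite_1[OF fin] by blast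
  then have im: "g ` {1..card I} = I" by (simp add: bij_betw_def)
  show "\<exists>V :: nat \<Rightarrow> 'c set. (\<forall>i\<in>{1..card I}. uniform_submodule R M (V i)) \<and> direct_sum M {1..card I} V \<and>
      essential_submodule R M (submodule_sum M {1..card I} V)"
  proof (intro exI conjI ballI)
    show "uniform_submodule R M (U (g i))" if "i \<in> {1..card I}" for i using U im that by blast
    show "direct_sum M {1..card I} (\<lambda>i. U (g i))" by (rule direct_sum_reindex[OF sU g dir])
    have "submodule_sum M {1..card I} (\<lambda>i. U (g i)) = submodule_sum M I U"
      by (rule submodule_sum_reindex[OF _ im]) (rule sU)
    then show "essential_submodule R M (submodule_sum M {1..card I} (\<lambda>i. U (g i)))"
      using ess by simp
  qed
  fix m
  assume "\<exists>V :: nat \<Rightarrow> 'c set. (\<forall>i\<in>{1..m}. uniform_submodule R M (V i)) \<and> direct_sum M {1..m} V \<and>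
      essential_submodule R M (submodule_sum M {1..m} V)"
  then obtain V :: "nat \<Rightarrow> 'c set" where "\<forall>i\<in>{1..m}. uniform_submodule R M (V i)"
    and Vd: "direct_sum M {1..m} V" and Ve: "essential_submodule R M (submodule_sum M {1..m} V)"
    by (elim exE conjE)
  then have V: "\<And>i. i \<in> {1..m} \<Longrightarrow> uniform_submodule R M (V i)" by simp
  have nz: "nonzero_submodule R M W" if "uniform_submodule R M W" for W
    using that by (simp add: uniform_submodule_iff)
  have "card {1..m} \<le> card I"
    by (rule card_le_if_essential_sum[OF fin U dir ess _ nz[OF V] Vd]) simp_all
  moreover have "card I \<le> card {1..m}"
    by (rule card_le_if_essential_sum[OF _ V Vd Ve fin nz[OF U] dir]) simp_all
  ultimately show "m = card I" by simp
qed

text \<open>\<open>K i\<close> is nonzero by irredundancy and misses \<open>A i\<close>, hence is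
  uniform. For \<open>j \<noteq> i\<close> the submodule \<open>K j\<close> lies in
  \<open>A i\<close>, so \<open>A i\<close> separates \<open>K i\<close> from the sum of the others,
  and the sum is direct.\<close>

lemma irredundant_meet_irreducible_family:
  fixes A :: "nat \<Rightarrow> 'c set"
  assumes fin: "finite I" and A: "\<And>i. i \<in> I \<Longrightarrow> meet_irreducible R M (A i)"
    and zero: "carrier M \<inter> (\<Inter>i\<in>I. A i) = {\<zero>\<^bsub>M\<^esub>}"
    and ne: "\<And>i. i \<in> I \<Longrightarrow> carrier M \<inter> (\<Inter>j\<in>I - {i}. A j) \<noteq> {\<zero>\<^bsub>M\<^esub>}"
  defines "K \<equiv> \<lambda>i. carrier M \<inter> (\<Inter>j\<in>I - {i}. A j)"
  shows "\<And>i. i \<in> I \<Longrightarrow> uniform_submodule R M (K i)"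
    and "\<And>i. i \<in> I \<Longrightarrow> K i \<inter> A i = {\<zero>\<^bsub>M\<^esub>}"
    and "\<And>i. i \<in> I \<Longrightarrow> submodule_sum M (I - {i}) K \<subseteq> A i"
    and "direct_sum M I K" and "udim R M = card I"
proof -
  have sA: "submodule (A i) R M" if "i \<in> I" for i
    using A[OF that] by (simp add: meet_irreducible_def)
  have sK: "submodule (K i) R M" if "i \<in> I" for i
    unfolding K_def using sA by (intro submodule_INT) auto
  have nK: "nonzero_submodule R M (K i)" if "i \<in> I" for i
    using sK[OF that] ne[OF that] by (simp add: K_def nonzero_submodule_def)
  show KA: "K i \<inter> A i = {\<zero>\<^bsub>M\<^esub>}" if i: "i \<in> I" for i
  proof -
    have "I = insert i (I - {i})" using i by auto
    then have "(\<Inter>j\<in>I. A j) = A i \<inter> (\<Inter>j\<in>I - {i}. A j)" by (metis INT_insert)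
    then show ?thesis unfolding K_def using zero by auto
  qed
  show uni: "uniform_submodule R M (K i)" if "i \<in> I" for i
    using uniform_if_disjoint_meet_irreducible[OF A nK KA] that by blast
  show sum: "submodule_sum M (I - {i}) K \<subseteq> A i" if i: "i \<in> I" for i
  proof (rule submodule_sum_least[OF sA[OF i]])
    fix j assume "j \<in> I - {i}"
    then show "K j \<subseteq> A i" unfolding K_def using i by blast
  qed
  show dir: "direct_sum M I K"
    unfolding direct_sum_def
  proof
    fix i assume i: "i \<in> I"
    have "K i \<inter> submodule_sum M (I - {i}) K \<subseteq> {\<zero>\<^bsub>M\<^esub>}" using KA[OF i] sum[OF i] by blast
    then show "K i \<inter> submodule_sum M (I - {i}) K = {\<zero>\<^bsub>M\<^esub>}"
      using submoduleD(2)[OF sK[OF i]] submodule_sum_zero[of "I - {i}" K] by blast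
  qed
  \<comment> \<open>The \<open>A i\<close> themselves bound the length of every direct sum by
    \<open>card I\<close>, so the \<open>K i\<close> form a direct sum of maximal length.\<close>
  have ess: "essential_submodule R M (submodule_sum M I K)"
  proof (rule essential_if_maximal_direct_sum[OF fin nK dir])
    fix T and V :: "nat \<Rightarrow> 'c set"
    assume T: "finite T" "\<And>t. t \<in> T \<Longrightarrow> nonzero_submodule R M (V t)" "direct_sum M T V"
    have "V t \<subseteq> carrier M" if "t \<in> T" for t
      using T(2)[OF that] submoduleD(1) by (auto simp: nonzero_submodule_def)
    then show "card T \<le> card I"
      using fin A T zero by (intro card_direct_sum_le[of I A "carrier M" T V] submodule_carrier) auto
  qed
  show "udim R M = card I" by (rule udim_eq_card[OF fin uni dir ess])
qed

text \<open>A minimal subfamily \<open>J\<close> with zero intersection is irredundant, so its size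
  is the uniform dimension, which is \<open>card I\<close>. Hence \<open>J = I\<close>.\<close>

lemma irredundant_if_card_eq_udim:
  fixes A :: "nat \<Rightarrow> 'c set"
  assumes fin: "finite I" and A: "\<And>i. i \<in> I \<Longrightarrow> meet_irreducible R M (A i)"
    and zero: "carrier M \<inter> (\<Inter>i\<in>I. A i) = {\<zero>\<^bsub>M\<^esub>}" and dim: "card I = udim R M" and i: "i \<in> I"
  shows "carrier M \<inter> (\<Inter>j\<in>I - {i}. A j) \<noteq> {\<zero>\<^bsub>M\<^esub>}"
proof -
  define \<J> where "\<J> = {J. J \<subseteq> I \<and> carrier M \<inter> (\<Inter>j\<in>J. A j) = {\<zero>\<^bsub>M\<^esub>}}"
  have "finite \<J>" using fin by (auto simp: \<J>_def)
  moreover have "I \<in> \<J>" using zero by (auto simp: \<J>_def)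
  ultimately obtain J where J: "J \<in> \<J>" and min: "\<And>J'. J' \<in> \<J> \<Longrightarrow> J' \<subseteq> J \<Longrightarrow> J = J'"
    using finite_has_minimal2[of \<J> I] by metis
  have JI: "J \<subseteq> I" and J0: "carrier M \<inter> (\<Inter>j\<in>J. A j) = {\<zero>\<^bsub>M\<^esub>}" using J by (auto simp: \<J>_def)
  have ne: "carrier M \<inter> (\<Inter>j\<in>J - {i}. A j) \<noteq> {\<zero>\<^bsub>M\<^esub>}" if "i \<in> J" for i
    using min[of "J - {i}"] JI that unfolding \<J>_def by blast
  have "udim R M = card J"
    using irredundant_meet_irreducible_family(5)[of J A] finite_subset[OF JI fin] A JI J0 ne by blast
  then have "J = I" using dim JI fin card_subset_eq by metis
  then show ?thesis using ne i by blast
qed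

text \<open>The family \<open>A\<close> bounds the length of direct sums by \<open>card I\<close>,
  and the \<open>U i\<close> attain this bound.\<close>

lemma essential_if_card_eq_udim:
  fixes A U :: "nat \<Rightarrow> 'c set"
  assumes fin: "finite I" and A: "\<And>i. i \<in> I \<Longrightarrow> meet_irreducible R M (A i)"
    and zero: "carrier M \<inter> (\<Inter>i\<in>I. A i) = {\<zero>\<^bsub>M\<^esub>}"
    and U: "\<And>i. i \<in> I \<Longrightarrow> nonzero_submodule R M (U i)" and dir: "direct_sum M I U"
  shows "essential_submodule R M (submodule_sum M I U)"
proof (rule essential_if_maximal_direct_sum[OF fin U dir])
  fix T and V :: "nat \<Rightarrow> 'c set"
  assume T: "finite T" "\<And>t. t \<in> T \<Longrightarrow> nonzero_submodule R M (V t)" "direct_sum M T V"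
  have "V t \<subseteq> carrier M" if "t \<in> T" for t
    using T(2)[OF that] submoduleD(1) by (auto simp: nonzero_submodule_def)
  then show "card T \<le> card I"
    using fin A T zero by (intro card_direct_sum_le[of I A "carrier M" T V] submodule_carrier) auto
qed

end

subsection \<open>Essential equivalence\<close>

lemma module_iso_iff:
  "h \<in> module_iso R M N \<longleftrightarrow> bij_betw h (carrier M) (carrier N) \<and>
    (\<forall>x\<in>carrier M. \<forall>y\<in>carrier M. h (x \<oplus>\<^bsub>M\<^esub> y) = h x \<oplus>\<^bsub>N\<^esub> h y) \<and>
    (\<forall>a\<in>carrier R. \<forall>x\<in>carrier M. h (a \<odot>\<^bsub>M\<^esub> x) = a \<odot>\<^bsub>N\<^esub> h x)"
  unfolding module_iso_def iso_def hom_def by (auto simp: bij_betw_def)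

lemma module_isoD:
  assumes "h \<in> module_iso R M N"
  shows "bij_betw h (carrier M) (carrier N)"
    and "x \<in> carrier M \<Longrightarrow> h x \<in> carrier N"
    and "x \<in> carrier M \<Longrightarrow> y \<in> carrier M \<Longrightarrow> h (x \<oplus>\<^bsub>M\<^esub> y) = h x \<oplus>\<^bsub>N\<^esub> h y"
    and "a \<in> carrier R \<Longrightarrow> x \<in> carrier M \<Longrightarrow> h (a \<odot>\<^bsub>M\<^esub> x) = a \<odot>\<^bsub>N\<^esub> h x"
  using assms by (auto simp: module_iso_iff bij_betw_def)

lemma module_hom_zero:
  assumes "left_module R M" "left_module R N" "h \<in> carrier M \<rightarrow> carrier N"
    and "\<And>a x. a \<in> carrier R \<Longrightarrow> x \<in> carrier M \<Longrightarrow> h (a \<odot>\<^bsub>M\<^esub> x) = a \<odot>\<^bsub>N\<^esub> h x"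
  shows "h \<zero>\<^bsub>M\<^esub> = \<zero>\<^bsub>N\<^esub>"
proof -
  interpret M: left_module R M by fact
  interpret N: left_module R N by fact
  have "h \<zero>\<^bsub>M\<^esub> = h (\<zero>\<^bsub>R\<^esub> \<odot>\<^bsub>M\<^esub> \<zero>\<^bsub>M\<^esub>)" by (simp add: M.smult_zero_left)
  also have "\<dots> = \<zero>\<^bsub>R\<^esub> \<odot>\<^bsub>N\<^esub> h \<zero>\<^bsub>M\<^esub>" using assms(4) by simp
  also have "\<dots> = \<zero>\<^bsub>N\<^esub>" using assms(3) by (intro N.smult_zero_left) auto
  finally show ?thesis .
qed

lemma submodule_image:
  assumes M: "left_module R M" and N: "left_module R N" and h: "h \<in> carrier M \<rightarrow> carrier N"
    and add: "\<And>x y. x \<in> carrier M \<Longrightarrow> y \<in> carrier M \<Longrightarrow> h (x \<oplus>\<^bsub>M\<^esub> y) = h x \<oplus>\<^bsub>N\<^esub> h y"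
    and smult: "\<And>a x. a \<in> carrier R \<Longrightarrow> x \<in> carrier M \<Longrightarrow> h (a \<odot>\<^bsub>M\<^esub> x) = a \<odot>\<^bsub>N\<^esub> h x"
    and X: "submodule X R M"
  shows "submodule (h ` X) R N"
proof -
  interpret M: left_module R M by fact
  interpret N: left_module R N by fact
  have sub: "x \<in> carrier M" if "x \<in> X" for x using M.submoduleD(1)[OF X] that by auto
  show ?thesis
  proof (rule N.submoduleI)
    show "h ` X \<subseteq> carrier N" using h sub by auto
    show "\<zero>\<^bsub>N\<^esub> \<in> h ` X"
      using module_hom_zero[OF M N h smult] M.submoduleD(2)[OF X] by (intro image_eqI) auto
    show "y \<oplus>\<^bsub>N\<^esub> y' \<in> h ` X" if y: "y \<in> h ` X" "y' \<in> h ` X" for y y'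
    proof -
      obtain x x' where "x \<in> X" "x' \<in> X" "y = h x" "y' = h x'" using y by auto
      then show ?thesis
        using add[OF sub sub, of x x'] M.submoduleD(3)[OF X, of x x']
        by (intro image_eqI[of _ h "x \<oplus>\<^bsub>M\<^esub> x'"]) auto
    qed
    show "a \<odot>\<^bsub>N\<^esub> y \<in> h ` X" if a: "a \<in> carrier R" and y: "y \<in> h ` X" for a y
    proof -
      obtain x where "x \<in> X" "y = h x" using y by auto
      then show ?thesis
        using smult[OF a sub, of x] M.submoduleD(4)[OF X a, of x]
        by (intro image_eqI[of _ h "a \<odot>\<^bsub>M\<^esub> x"]) auto
    qed
  qed
qed

lemma module_iso_submodule:
  assumes "left_module R M" "left_module R N" "h \<in> module_iso R M N" "submodule X R M"
  shows "submodule (h ` X) R N"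
  using assms by (intro submodule_image[of R M N]) (auto intro: module_isoD)

lemma module_iso_inv:
  assumes M: "left_module R M" and h: "h \<in> module_iso R M N"
  shows "inv_into (carrier M) h \<in> module_iso R N M"
proof -
  interpret M: left_module R M by fact
  let ?k = "inv_into (carrier M) h"
  have bij: "bij_betw h (carrier M) (carrier N)" using h by (rule module_isoD)
  then have k: "?k (h x) = x" if "x \<in> carrier M" for x
    using that by (simp add: bij_betw_def)
  have ex: "\<exists>x\<in>carrier M. y = h x" if "y \<in> carrier N" for y
    using bij that by (auto simp: bij_betw_def)
  show ?thesis
    unfolding module_iso_iff
  proof (intro conjI ballI)
    show "bij_betw ?k (carrier N) (carrier M)" using bij by (rule bij_betw_inv_into)
    show "?k (y \<oplus>\<^bsub>N\<^esub> y') = ?k y \<oplus>\<^bsub>M\<^esub> ?k y'" if y: "y \<in> carrier N" "y' \<in> carrier N" for y y'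
    proof -
      obtain x x' where x: "x \<in> carrier M" "x' \<in> carrier M" "y = h x" "y' = h x'"
        using ex y by metis
      then have "y \<oplus>\<^bsub>N\<^esub> y' = h (x \<oplus>\<^bsub>M\<^esub> x')" using module_isoD(3)[OF h] by simp
      then show ?thesis using x by (simp add: k)
    qed
    show "?k (a \<odot>\<^bsub>N\<^esub> y) = a \<odot>\<^bsub>M\<^esub> ?k y" if a: "a \<in> carrier R" and y: "y \<in> carrier N" for a y
    proof -
      obtain x where x: "x \<in> carrier M" "y = h x" using ex y by metis
      then have "a \<odot>\<^bsub>N\<^esub> y = h (a \<odot>\<^bsub>M\<^esub> x)" using module_isoD(4)[OF h a] by simp
      then show ?thesis using x a by (simp add: k)
    qed
  qed
qed

lemma module_iso_comp:
  assumes "h \<in> module_iso R M N" "g \<in> module_iso R N P"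
  shows "g \<circ> h \<in> module_iso R M P"
  using bij_betw_trans[OF module_isoD(1)[OF assms(1)] module_isoD(1)[OF assms(2)]]
    module_isoD[OF assms(1)] module_isoD[OF assms(2)]
  by (simp add: module_iso_iff)

lemma module_iso_restrict:
  assumes "h \<in> module_iso R M N" "X \<subseteq> carrier M"
  shows "h \<in> module_iso R (M\<lparr>carrier := X\<rparr>) (N\<lparr>carrier := h ` X\<rparr>)"
  using assms by (auto simp: module_iso_iff bij_betw_def subset_iff intro: inj_on_subset)

section \<open>Essential submodules\<close>

lemma (in left_module) essential_submodule_carrier: "essential_submodule R M (carrier M)"
proof -
  have "carrier M \<inter> L = L" if "nonzero_submodule R M L" for L
    using that submoduleD(1) by (auto simp: nonzero_submodule_def)
  then show ?thesis
    using submodule_carrier by (auto simp: essential_submodule_def nonzero_submodule_def)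
qed

lemma (in left_module) essential_submodule_Int:
  assumes "essential_submodule R M L" "essential_submodule R M P"
  shows "essential_submodule R M (L \<inter> P)"
proof -
  have sub: "submodule L R M" "submodule P R M" using assms by (auto simp: essential_submodule_def)
  have "L \<inter> P \<inter> X \<noteq> {\<zero>\<^bsub>M\<^esub>}" if X: "nonzero_submodule R M X" for X
  proof -
    have "nonzero_submodule R M (P \<inter> X)"
      using assms(2) X sub submodule_Int[of P X] by (simp add: essential_submodule_def nonzero_submodule_def)
    then show ?thesis using assms(1) unfolding essential_submodule_def Int_assoc by blast
  qed
  then show ?thesis using submodule_Int[OF sub] by (simp add: essential_submodule_def)
qed

lemma (in left_module) essential_submodule_update:
  assumes "essential_submodule R M X" "submodule L R M" "X \<subseteq> L"
  shows "essential_submodule R (M\<lparr>carrier := L\<rparr>) X"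
  using assms
  by (simp add: essential_submodule_def submodule_update_iff nonzero_submodule_update_iff)

text \<open>A nonzero \<open>Y\<close> meets \<open>L\<close> in a nonzero submodule of
  \<open>L\<close>, which in turn meets \<open>X\<close>; as \<open>X \<subseteq> L\<close>, this
  happens inside \<open>X \<inter> Y\<close>.\<close>

lemma (in left_module) essential_submodule_trans:
  assumes L: "essential_submodule R M L" and X: "essential_submodule R (M\<lparr>carrier := L\<rparr>) X"
  shows "essential_submodule R M X"
proof -
  have sL: "submodule L R M" using L by (simp add: essential_submodule_def)
  have sX: "submodule X R M" "X \<subseteq> L"
    using X sL by (simp_all add: essential_submodule_def submodule_update_iff)
  have "X \<inter> Y \<noteq> {\<zero>\<^bsub>M\<^esub>}" if Y: "nonzero_submodule R M Y" for Y
  proof -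
    have "nonzero_submodule R M (L \<inter> Y)"
      using L Y submodule_Int[OF sL, of Y] by (simp add: essential_submodule_def nonzero_submodule_def)
    then have "X \<inter> (L \<inter> Y) \<noteq> {\<zero>\<^bsub>M\<^esub>}"
      using X sL by (simp add: essential_submodule_def nonzero_submodule_update_iff)
    moreover have "X \<inter> (L \<inter> Y) = X \<inter> Y" using sX(2) by blast
    ultimately show ?thesis by simp
  qed
  then show ?thesis using sX by (simp add: essential_submodule_def)
qed

text \<open>A nonzero submodule of \<open>N\<close> is pulled back along the inverse, meets
  \<open>X\<close> in a nonzero element there, and that element is mapped forward again.\<close>

lemma module_iso_essential:
  assumes M: "left_module R M" and N: "left_module R N" and h: "h \<in> module_iso R M N"
    and X: "essential_submodule R M X"
  shows "essential_submodule R N (h ` X)"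
proof -
  interpret M: left_module R M by fact
  interpret N: left_module R N by fact
  let ?k = "inv_into (carrier M) h"
  have inj: "inj_on h (carrier M)" and im: "h ` carrier M = carrier N"
    using module_isoD(1)[OF h] by (auto simp: bij_betw_def)
  have h0: "h \<zero>\<^bsub>M\<^esub> = \<zero>\<^bsub>N\<^esub>" using module_isoD[OF h] by (intro module_hom_zero[OF M N]) auto
  have sX: "submodule X R M" using X by (simp add: essential_submodule_def)
  have sub: "submodule (h ` X) R N" by (rule module_iso_submodule[OF M N h sX])
  have "h ` X \<inter> Y \<noteq> {\<zero>\<^bsub>N\<^esub>}" if Y: "nonzero_submodule R N Y" for Y
  proof -
    have sY: "submodule Y R N" using Y by (simp add: nonzero_submodule_def)
    then have Yc: "Y \<subseteq> carrier N" by (rule N.submoduleD)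
    have skY: "submodule (?k ` Y) R M"
      using sY by (rule module_iso_submodule[OF N M module_iso_inv[OF M h]])
    obtain y where y: "y \<in> Y" "y \<noteq> \<zero>\<^bsub>N\<^esub>" using Y by (rule N.nonzero_submoduleE)
    have hk: "h (?k y) = y" if "y \<in> Y" for y
      using that Yc im by (intro f_inv_into_f) auto
    have "?k y \<noteq> \<zero>\<^bsub>M\<^esub>" using hk[OF y(1)] h0 y(2) by auto
    then have "nonzero_submodule R M (?k ` Y)" using skY y(1) by (auto simp: nonzero_submodule_def)
    then have "X \<inter> ?k ` Y \<noteq> {\<zero>\<^bsub>M\<^esub>}" using X by (simp add: essential_submodule_def)
    moreover have "\<zero>\<^bsub>M\<^esub> \<in> X \<inter> ?k ` Y" using M.submoduleD(2) sX skY by auto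
    ultimately obtain x where x: "x \<in> X" "x \<in> ?k ` Y" "x \<noteq> \<zero>\<^bsub>M\<^esub>" by blast
    have xc: "x \<in> carrier M" using x(1) M.submoduleD(1)[OF sX] by auto
    have "h x \<in> Y" using x(2) hk by auto
    moreover have "h x \<noteq> \<zero>\<^bsub>N\<^esub>" using inj_onD[OF inj _ xc M.zero_closed] x(3) h0 by auto
    ultimately show ?thesis using x(1) by blast
  qed
  then show ?thesis using sub by (simp add: essential_submodule_def)
qed

section \<open>Symmetry and transitivity of essential equivalence\<close>

lemma essentially_equivalent_sym:
  assumes M: "left_module R M" and "essentially_equivalent R M N"
  shows "essentially_equivalent R N M"
proof -
  obtain L P h where *: "essential_submodule R M L" "essential_submodule R N P"
      "h \<in> module_iso R (M\<lparr>carrier := L\<rparr>) (N\<lparr>carrier := P\<rparr>)"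
    using assms(2) unfolding essentially_equivalent_def by blast
  have "left_module R (M\<lparr>carrier := L\<rparr>)"
    using *(1) by (intro left_module.submodule_left_module[OF M]) (simp add: essential_submodule_def)
  from module_iso_inv[OF this *(3)] *(1,2) show ?thesis
    unfolding essentially_equivalent_def by blast
qed

text \<open>After reversing the first equivalence both isomorphisms start from essential submodules
  of \<open>N\<close>. Restricted to the intersection \<open>T\<close> of these, which is still
  essential, they have essential images in \<open>M\<close> and \<open>P\<close>, and the images are
  isomorphic through \<open>T\<close>.\<close>

lemma essentially_equivalent_trans:
  assumes M: "left_module R M" and N: "left_module R N" and P: "left_module R P"
    and MN: "essentially_equivalent R M N" and NP: "essentially_equivalent R N P"
  shows "essentially_equivalent R M P"
proof -
  interpret M: left_module R M by fact
  interpret N: left_module R N by fact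
  interpret P: left_module R P by fact
  obtain L1 L2 h where L1: "essential_submodule R N L1" and L2: "essential_submodule R M L2"
      and h: "h \<in> module_iso R (N\<lparr>carrier := L1\<rparr>) (M\<lparr>carrier := L2\<rparr>)"
    using essentially_equivalent_sym[OF M MN] unfolding essentially_equivalent_def by blast
  obtain P1 P2 g where P1: "essential_submodule R N P1" and P2: "essential_submodule R P P2"
      and g: "g \<in> module_iso R (N\<lparr>carrier := P1\<rparr>) (P\<lparr>carrier := P2\<rparr>)"
    using NP unfolding essentially_equivalent_def by blast
  have sub: "submodule L1 R N" "submodule P1 R N" "submodule L2 R M" "submodule P2 R P"
    using L1 L2 P1 P2 by (simp_all add: essential_submodule_def)
  note lm = N.submodule_left_module[OF sub(1)] N.submodule_left_module[OF sub(2)]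
    M.submodule_left_module[OF sub(3)] P.submodule_left_module[OF sub(4)]
  define T where "T = L1 \<inter> P1"
  have T: "essential_submodule R N T" unfolding T_def by (rule N.essential_submodule_Int[OF L1 P1])
  have "essential_submodule R (N\<lparr>carrier := L1\<rparr>) T"
    by (rule N.essential_submodule_update[OF T sub(1)]) (simp add: T_def)
  then have hT: "essential_submodule R M (h ` T)"
    using module_iso_essential[OF lm(1) lm(3) h] M.essential_submodule_trans[OF L2] by blast
  have "essential_submodule R (N\<lparr>carrier := P1\<rparr>) T"
    by (rule N.essential_submodule_update[OF T sub(2)]) (simp add: T_def)
  then have gT: "essential_submodule R P (g ` T)"
    using module_iso_essential[OF lm(2) lm(4) g] P.essential_submodule_trans[OF P2] by blast
  have "left_module R (N\<lparr>carrier := T\<rparr>)"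
    using T by (intro N.submodule_left_module) (simp add: essential_submodule_def)
  moreover have "h \<in> module_iso R (N\<lparr>carrier := T\<rparr>) (M\<lparr>carrier := h ` T\<rparr>)"
    using module_iso_restrict[OF h, of T] by (simp add: T_def)
  moreover have "g \<in> module_iso R (N\<lparr>carrier := T\<rparr>) (P\<lparr>carrier := g ` T\<rparr>)"
    using module_iso_restrict[OF g, of T] by (simp add: T_def)
  ultimately have "g \<circ> inv_into T h \<in> module_iso R (M\<lparr>carrier := h ` T\<rparr>) (P\<lparr>carrier := g ` T\<rparr>)"
    using module_iso_comp module_iso_inv by fastforce
  then show ?thesis using hT gT unfolding essentially_equivalent_def by blast
qed

lemma ess_class_eqI:
  assumes "left_module R M" "left_module R N" "essentially_equivalent R M N"
  shows "ess_class R M = ess_class R N"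
  unfolding ess_class_def
  using essentially_equivalent_trans essentially_equivalent_sym assms by blast

text \<open>The image is a nonzero submodule of a uniform module, hence essential; \<open>M\<close>
  itself and this image are the required essential submodules.\<close>

lemma essentially_equivalent_if_embeds_in_uniform:
  assumes M: "left_module R M" and N: "left_module R N" and uni: "uniform_module R N"
    and nz: "carrier M \<noteq> {\<zero>\<^bsub>M\<^esub>}" and h: "h \<in> carrier M \<rightarrow> carrier N" and inj: "inj_on h (carrier M)"
    and add: "\<And>x y. x \<in> carrier M \<Longrightarrow> y \<in> carrier M \<Longrightarrow> h (x \<oplus>\<^bsub>M\<^esub> y) = h x \<oplus>\<^bsub>N\<^esub> h y"
    and smult: "\<And>a x. a \<in> carrier R \<Longrightarrow> x \<in> carrier M \<Longrightarrow> h (a \<odot>\<^bsub>M\<^esub> x) = a \<odot>\<^bsub>N\<^esub> h x"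
  shows "essentially_equivalent R M N"
proof -
  interpret M: left_module R M by fact
  have sub: "submodule (h ` carrier M) R N"
    by (rule submodule_image[OF M N h add smult M.submodule_carrier])
  obtain x where x: "x \<in> carrier M" "x \<noteq> \<zero>\<^bsub>M\<^esub>" using nz by blast
  have "h x \<noteq> h \<zero>\<^bsub>M\<^esub>" using inj_onD[OF inj _ x(1) M.zero_closed] x(2) by auto
  then have "h x \<noteq> \<zero>\<^bsub>N\<^esub>" using module_hom_zero[OF M N h smult] by simp
  then have "nonzero_submodule R N (h ` carrier M)" using sub x(1) by (auto simp: nonzero_submodule_def)
  then have "essential_submodule R N (h ` carrier M)" using uni by (simp add: uniform_module_def)
  moreover have "h \<in> module_iso R (M\<lparr>carrier := carrier M\<rparr>) (N\<lparr>carrier := h ` carrier M\<rparr>)"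
    using inj add smult by (simp add: module_iso_iff bij_betw_def)
  ultimately show ?thesis
    using M.essential_submodule_carrier unfolding essentially_equivalent_def by blast
qed

text \<open>The inclusion of a uniform submodule is an embedding into a uniform module, so its class
  is that of \<open>M\<close>; and the class of \<open>M\<close> occurs because \<open>M\<close> is
  a uniform submodule of itself.\<close>

lemma As_uniform_module:
  assumes M: "left_module R M" and uni: "uniform_module R M"
  shows "As R M = {ess_class R M}"
proof -
  interpret left_module R M by fact
  have "ess_class R (M\<lparr>carrier := U\<rparr>) = ess_class R M" if U: "uniform_submodule R M U" for U
  proof (rule ess_class_eqI)
    have sU: "submodule U R M" "U \<noteq> {\<zero>\<^bsub>M\<^esub>}"
      using U unfolding uniform_submodule_iff nonzero_submodule_def by auto
    show lm: "left_module R (M\<lparr>carrier := U\<rparr>)" using sU(1) by (rule submodule_left_module)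
    show "essentially_equivalent R (M\<lparr>carrier := U\<rparr>) M"
      using sU submoduleD(1)[OF sU(1)]
      by (intro essentially_equivalent_if_embeds_in_uniform[OF lm M uni, where h = id]) auto
  qed (fact M)
  moreover have eq: "M\<lparr>carrier := carrier M\<rparr> = M" by simp
  have "uniform_submodule R M (carrier M)"
    using uni submodule_carrier unfolding uniform_submodule_def eq by blast
  ultimately show ?thesis unfolding As_def using eq by auto
qed

subsection \<open>Factor modules\<close>

context left_module
begin

section \<open>Cosets and the canonical projections\<close>

lemma rcos_eq_iff:
  assumes N: "submodule N R M" and x: "x \<in> carrier M" and y: "y \<in> carrier M"
  shows "N +>\<^bsub>M\<^esub> x = N +>\<^bsub>M\<^esub> y \<longleftrightarrow> x \<ominus>\<^bsub>M\<^esub> y \<in> N"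
proof -
  interpret N: submodule N R M by fact
  interpret A: abelian_subgroup N M
    by (intro abelian_subgroupI3 additive_subgroup.intro N.subgroup_axioms M.abelian_group_axioms)
  show ?thesis
  proof
    assume "N +>\<^bsub>M\<^esub> x = N +>\<^bsub>M\<^esub> y"
    then have "x \<in> N +>\<^bsub>M\<^esub> y" using A.a_rcos_self[OF x] by simp
    then obtain n where n: "n \<in> N" "x = n \<oplus>\<^bsub>M\<^esub> y" by (auto simp: a_r_coset_def')
    then show "x \<ominus>\<^bsub>M\<^esub> y \<in> N" using add_minus_cancel(2)[of n y] y submoduleD(1)[OF N] by auto
  next
    assume n: "x \<ominus>\<^bsub>M\<^esub> y \<in> N"
    have "x = (x \<ominus>\<^bsub>M\<^esub> y) \<oplus>\<^bsub>M\<^esub> y" using x y by (simp add: a_minus_def M.a_assoc M.l_neg)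
    with n have "x \<in> N +>\<^bsub>M\<^esub> y" unfolding a_r_coset_def' by blast
    then show "N +>\<^bsub>M\<^esub> x = N +>\<^bsub>M\<^esub> y"
      using a_repr_independence[OF _ y A.a_subgroup] by simp
  qed
qed

lemma rcos_self:
  assumes "submodule N R M" "x \<in> carrier M"
  shows "x \<in> N +>\<^bsub>M\<^esub> x"
  using assms submoduleD(2)[OF assms(1)] by (force simp: a_r_coset_def')

lemma quot_carrierE:
  assumes "X \<in> carrier (M QuotMod N)"
  obtains x where "x \<in> carrier M" "X = N +>\<^bsub>M\<^esub> x"
  using assms by (auto simp: quot_module_def A_RCOSETS_def')

lemma rcos_in_carrier: "x \<in> carrier M \<Longrightarrow> N +>\<^bsub>M\<^esub> x \<in> carrier (M QuotMod N)"
  unfolding quot_module_def A_RCOSETS_def' by (simp only: partial_object.simps) blast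

lemma rcos_zero: "submodule N R M \<Longrightarrow> \<zero>\<^bsub>M QuotMod N\<^esub> = N +>\<^bsub>M\<^esub> \<zero>\<^bsub>M\<^esub>"
  using submoduleD(1)[of N] by (simp add: quot_module_def)

lemma rcos_eq_zero_iff:
  assumes "submodule N R M" "x \<in> carrier M"
  shows "N +>\<^bsub>M\<^esub> x = \<zero>\<^bsub>M QuotMod N\<^esub> \<longleftrightarrow> x \<in> N"
proof -
  have "x \<ominus>\<^bsub>M\<^esub> \<zero>\<^bsub>M\<^esub> = x" using add_minus_cancel(2)[of x "\<zero>\<^bsub>M\<^esub>"] assms(2) by simp
  then show ?thesis using assms by (simp add: rcos_zero rcos_eq_iff)
qed

lemma rcos_add:
  assumes N: "submodule N R M" and "x \<in> carrier M" "y \<in> carrier M"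
  shows "N +>\<^bsub>M\<^esub> (x \<oplus>\<^bsub>M\<^esub> y) = (N +>\<^bsub>M\<^esub> x) \<oplus>\<^bsub>M QuotMod N\<^esub> (N +>\<^bsub>M\<^esub> y)"
proof -
  interpret N: submodule N R M by fact
  interpret A: abelian_subgroup N M
    by (intro abelian_subgroupI3 additive_subgroup.intro N.subgroup_axioms M.abelian_group_axioms)
  show ?thesis using assms by (simp add: quot_module_def A.a_rcos_sum)
qed

text \<open>If \<open>X\<close> is a coset of a submodule of \<open>P\<close>, all members of the union are equal.\<close>

definition coset_map :: "'c set \<Rightarrow> 'c set \<Rightarrow> 'c set"
  where "coset_map P X = (\<Union>x\<in>X. P +>\<^bsub>M\<^esub> x)"

text \<open>Identifies \<open>coset_map P\<close> as the canonical map from \<open>M/N\<close> to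
  \<open>M/P\<close>: elements of one coset of \<open>N\<close> differ by elements of
  \<open>N \<subseteq> P\<close>.\<close>

lemma coset_map_rcos:
  assumes N: "submodule N R M" and P: "submodule P R M" and NP: "N \<subseteq> P" and x: "x \<in> carrier M"
  shows "coset_map P (N +>\<^bsub>M\<^esub> x) = P +>\<^bsub>M\<^esub> x"
proof -
  have "P +>\<^bsub>M\<^esub> y = P +>\<^bsub>M\<^esub> x" if y: "y \<in> N +>\<^bsub>M\<^esub> x" for y
  proof -
    obtain n where n: "n \<in> N" "y = n \<oplus>\<^bsub>M\<^esub> x" using y by (auto simp: a_r_coset_def')
    then have "n \<in> carrier M" using submoduleD(1)[OF N] by auto
    then show ?thesis using n NP x add_minus_cancel(2)[of n x] by (subst rcos_eq_iff[OF P]) auto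
  qed
  then show ?thesis unfolding coset_map_def using rcos_self[OF N x] by blast
qed

lemma rcos_smult:
  assumes N: "submodule N R M" and a: "a \<in> carrier R" and x: "x \<in> carrier M"
  shows "N +>\<^bsub>M\<^esub> (a \<odot>\<^bsub>M\<^esub> x) = a \<odot>\<^bsub>M QuotMod N\<^esub> (N +>\<^bsub>M\<^esub> x)"
proof -
  have "N +>\<^bsub>M\<^esub> (a \<odot>\<^bsub>M\<^esub> y) = N +>\<^bsub>M\<^esub> (a \<odot>\<^bsub>M\<^esub> x)" if y: "y \<in> N +>\<^bsub>M\<^esub> x" for y
  proof -
    obtain n where n: "n \<in> N" "y = n \<oplus>\<^bsub>M\<^esub> x" using y by (auto simp: a_r_coset_def')
    then have nc: "n \<in> carrier M" using submoduleD(1)[OF N] by auto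
    then have "a \<odot>\<^bsub>M\<^esub> y \<ominus>\<^bsub>M\<^esub> a \<odot>\<^bsub>M\<^esub> x = a \<odot>\<^bsub>M\<^esub> n"
      using n a x by (simp add: smult_r_distr add_minus_cancel)
    then show ?thesis
      using n nc a x submoduleD(4)[OF N a n(1)] rcos_eq_iff[OF N, of "a \<odot>\<^bsub>M\<^esub> y" "a \<odot>\<^bsub>M\<^esub> x"]
      by simp
  qed
  then have "(\<Union>y\<in>N +>\<^bsub>M\<^esub> x. N +>\<^bsub>M\<^esub> (a \<odot>\<^bsub>M\<^esub> y)) = N +>\<^bsub>M\<^esub> (a \<odot>\<^bsub>M\<^esub> x)"
    using rcos_self[OF N x] by blast
  then show ?thesis by (simp add: quot_module_def)
qed

section \<open>Submodules of a factor module\<close>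

lemma submodule_quot_submodule:
  assumes N: "submodule N R M" and X: "submodule X R M"
  shows "submodule (quot_submodule M X N) R (M QuotMod N)"
  unfolding quot_submodule_def
  by (rule submodule_image[OF left_module_axioms quot_module_left_module[OF N] _ _ _ X])
    (simp_all add: N rcos_in_carrier rcos_add rcos_smult)

text \<open>Since \<open>N \<subseteq> X\<close>, membership in \<open>X\<close> does not depend on
  the representative of a coset.\<close>

lemma rcos_in_quot_submodule_iff:
  assumes N: "submodule N R M" and X: "submodule X R M" and NX: "N \<subseteq> X" and x: "x \<in> carrier M"
  shows "N +>\<^bsub>M\<^esub> x \<in> quot_submodule M X N \<longleftrightarrow> x \<in> X"
proof
  assume "N +>\<^bsub>M\<^esub> x \<in> quot_submodule M X N"
  then obtain y where y: "y \<in> X" "N +>\<^bsub>M\<^esub> x = N +>\<^bsub>M\<^esub> y" by (auto simp: quot_submodule_def)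
  have yc: "y \<in> carrier M" using y(1) submoduleD(1)[OF X] by auto
  have "x \<ominus>\<^bsub>M\<^esub> y \<in> X" using y NX rcos_eq_iff[OF N x yc] by auto
  then have "(x \<ominus>\<^bsub>M\<^esub> y) \<oplus>\<^bsub>M\<^esub> y \<in> X" using y(1) by (rule submoduleD(3)[OF X])
  then show "x \<in> X" using x yc by (simp add: a_minus_def M.a_assoc M.l_neg)
qed (auto simp: quot_submodule_def)

text \<open>Half of the correspondence theorem; \<open>X\<close> is the preimage of \<open>Y\<close>
  under the projection.\<close>

lemma quot_submodule_preimage:
  assumes N: "submodule N R M" and Y: "submodule Y R (M QuotMod N)"
  obtains X where "submodule X R M" "N \<subseteq> X" "Y = quot_submodule M X N"
proof
  interpret Q: left_module R "M QuotMod N" using N by (rule quot_module_left_module)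
  let ?X = "{x \<in> carrier M. N +>\<^bsub>M\<^esub> x \<in> Y}"
  show "submodule ?X R M"
    using Q.submoduleD(2-4)[OF Y] N
    by (intro submoduleI) (auto simp: rcos_zero[symmetric] rcos_add rcos_smult)
  show "N \<subseteq> ?X"
  proof
    fix x assume x: "x \<in> N"
    then have "x \<in> carrier M" using submoduleD(1)[OF N] by auto
    moreover from this have "N +>\<^bsub>M\<^esub> x = \<zero>\<^bsub>M QuotMod N\<^esub>" using rcos_eq_zero_iff[OF N] x by simp
    ultimately show "x \<in> ?X" using Q.submoduleD(2)[OF Y] by simp
  qed
  have "z \<in> quot_submodule M ?X N" if z: "z \<in> Y" for z
  proof -
    have "z \<in> carrier (M QuotMod N)" using Q.submoduleD(1)[OF Y] z by auto
    then show ?thesis using z by (elim quot_carrierE) (auto simp: quot_submodule_def)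
  qed
  then show "Y = quot_submodule M ?X N" by (auto simp: quot_submodule_def)
qed

text \<open>Submodules strictly above \<open>A\<close> have nonzero images in \<open>M/A\<close>. By
  uniformity two such images share a nonzero coset, whose representative in \<open>X\<close> lies in
  \<open>Y\<close> but not in \<open>A\<close>.\<close>

lemma meet_irreducible_if_uniform_quotient:
  assumes A: "submodule A R M" and uni: "uniform_module R (M QuotMod A)"
  shows "meet_irreducible R M A"
proof -
  interpret Q: left_module R "M QuotMod A" using A by (rule quot_module_left_module)
  have strict: "nonzero_submodule R (M QuotMod A) (quot_submodule M X A)"
    if X: "submodule X R M" "A \<subset> X" for X
  proof -
    obtain x where x: "x \<in> X" "x \<notin> A" using X(2) by blast
    then have "A +>\<^bsub>M\<^esub> x \<noteq> \<zero>\<^bsub>M QuotMod A\<^esub>"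
      using rcos_eq_zero_iff[OF A] submoduleD(1)[OF X(1)] by blast
    then show ?thesis
      using x submodule_quot_submodule[OF A X(1)] by (auto simp: nonzero_submodule_def quot_submodule_def)
  qed
  have "X \<inter> Y \<noteq> A" if X: "submodule X R M" "A \<subset> X" and Y: "submodule Y R M" "A \<subset> Y" for X Y
  proof -
    have ne: "quot_submodule M X A \<inter> quot_submodule M Y A \<noteq> {\<zero>\<^bsub>M QuotMod A\<^esub>}"
      using uni strict[OF X] strict[OF Y] unfolding Q.uniform_module_iff by blast
    have "\<zero>\<^bsub>M QuotMod A\<^esub> \<in> quot_submodule M X A \<inter> quot_submodule M Y A"
      using Q.submoduleD(2) submodule_quot_submodule[OF A] X Y by blast
    then obtain z where z: "z \<in> quot_submodule M X A" "z \<in> quot_submodule M Y A"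
        "z \<noteq> \<zero>\<^bsub>M QuotMod A\<^esub>" using ne by blast
    then obtain x where x: "x \<in> X" "z = A +>\<^bsub>M\<^esub> x" by (auto simp: quot_submodule_def)
    have xc: "x \<in> carrier M" using x submoduleD(1)[OF X(1)] by auto
    have "x \<in> Y" using z(2) x rcos_in_quot_submodule_iff[OF A Y(1) _ xc] Y(2) by auto
    moreover have "x \<notin> A" using z(3) x(2) rcos_eq_zero_iff[OF A xc] by auto
    ultimately show ?thesis using x(1) by blast
  qed
  moreover have "A \<noteq> carrier M"
  proof
    assume "A = carrier M"
    then have "z = \<zero>\<^bsub>M QuotMod A\<^esub>" if "z \<in> carrier (M QuotMod A)" for z
      using that rcos_eq_zero_iff[OF A] by (auto elim!: quot_carrierE)
    then show False using uni Q.zero_closed unfolding uniform_module_def by blast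
  qed
  ultimately show ?thesis using A by (simp add: meet_irreducible_def)
qed

text \<open>By the correspondence theorem, writing \<open>A/N\<close> as an intersection of two
  larger submodules of \<open>M/N\<close> would lift to such an expression of \<open>A\<close> in
  \<open>M\<close>.\<close>

lemma meet_irreducible_quot_submodule:
  assumes N: "submodule N R M" and NA: "N \<subseteq> A" and A: "meet_irreducible R M A"
  shows "meet_irreducible R (M QuotMod N) (quot_submodule M A N)"
proof -
  have sA: "submodule A R M" "A \<noteq> carrier M" using A by (auto simp: meet_irreducible_def)
  have mem: "N +>\<^bsub>M\<^esub> x \<in> quot_submodule M X N \<longleftrightarrow> x \<in> X"
    if "submodule X R M" "N \<subseteq> X" "x \<in> carrier M" for X x
    using that by (intro rcos_in_quot_submodule_iff[OF N])
  have "X \<inter> Y \<noteq> quot_submodule M A N"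
    if X: "submodule X R (M QuotMod N)" "quot_submodule M A N \<subset> X"
      and Y: "submodule Y R (M QuotMod N)" "quot_submodule M A N \<subset> Y" for X Y
  proof
    assume XY: "X \<inter> Y = quot_submodule M A N"
    obtain X' where X': "submodule X' R M" "N \<subseteq> X'" "X = quot_submodule M X' N"
      using quot_submodule_preimage[OF N X(1)] .
    obtain Y' where Y': "submodule Y' R M" "N \<subseteq> Y'" "Y = quot_submodule M Y' N"
      using quot_submodule_preimage[OF N Y(1)] .
    have sub: "X' \<subseteq> carrier M" "Y' \<subseteq> carrier M" "A \<subseteq> carrier M"
      using submoduleD(1) X'(1) Y'(1) sA(1) by auto
    have "x \<in> X' \<and> x \<in> Y' \<longleftrightarrow> x \<in> A" if "x \<in> carrier M" for x
      using XY mem[OF X'(1,2) that] mem[OF Y'(1,2) that] mem[OF sA(1) NA that] X'(3) Y'(3) by blast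
    then have int: "X' \<inter> Y' = A" using sub by blast
    moreover have "A \<noteq> X'" "A \<noteq> Y'" using X(2) Y(2) X'(3) Y'(3) by auto
    ultimately have "A \<subset> X'" "A \<subset> Y'" by auto
    then show False using A X'(1) Y'(1) int by (auto simp: meet_irreducible_def)
  qed
  moreover have "quot_submodule M A N \<noteq> carrier (M QuotMod N)"
  proof
    assume eq: "quot_submodule M A N = carrier (M QuotMod N)"
    have "carrier M \<subseteq> A"
      using mem[OF sA(1) NA] rcos_in_carrier[of _ N] unfolding eq by blast
    then show False using sA submoduleD(1) by auto
  qed
  ultimately show ?thesis
    using submodule_quot_submodule[OF N sA(1)] by (simp add: meet_irreducible_def)
qed

text \<open>Translates between decompositions of \<open>N\<close> in \<open>M\<close> and of zero in
  \<open>M/N\<close>. The intersections with the carriers keep this valid for the empty family,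
  which arises when the only component is dropped.\<close>

lemma quot_INT_eq_zero_iff:
  assumes N: "submodule N R M" and A: "\<And>i. i \<in> I \<Longrightarrow> submodule (A i) R M"
    and NA: "\<And>i. i \<in> I \<Longrightarrow> N \<subseteq> A i"
  shows "carrier (M QuotMod N) \<inter> (\<Inter>i\<in>I. quot_submodule M (A i) N) = {\<zero>\<^bsub>M QuotMod N\<^esub>} \<longleftrightarrow>
    carrier M \<inter> (\<Inter>i\<in>I. A i) = N"
proof -
  have mem: "N +>\<^bsub>M\<^esub> x \<in> (\<Inter>i\<in>I. quot_submodule M (A i) N) \<longleftrightarrow> x \<in> (\<Inter>i\<in>I. A i)"
    if "x \<in> carrier M" for x
    using that A NA rcos_in_quot_submodule_iff[OF N] by auto
  have Nc: "N \<subseteq> carrier M" using N by (rule submoduleD)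
  show ?thesis
  proof
    assume *: "carrier (M QuotMod N) \<inter> (\<Inter>i\<in>I. quot_submodule M (A i) N) = {\<zero>\<^bsub>M QuotMod N\<^esub>}"
    have "x \<in> N" if "x \<in> carrier M" "x \<in> (\<Inter>i\<in>I. A i)" for x
      using * that mem[OF that(1)] rcos_in_carrier[OF that(1), of N] rcos_eq_zero_iff[OF N that(1)]
      by blast
    then show "carrier M \<inter> (\<Inter>i\<in>I. A i) = N" using Nc NA by blast
  next
    assume *: "carrier M \<inter> (\<Inter>i\<in>I. A i) = N"
    have "z = \<zero>\<^bsub>M QuotMod N\<^esub>"
      if z: "z \<in> carrier (M QuotMod N)" "z \<in> (\<Inter>i\<in>I. quot_submodule M (A i) N)" for z
    proof -
      obtain x where x: "x \<in> carrier M" "z = N +>\<^bsub>M\<^esub> x" using z(1) by (rule quot_carrierE)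
      then have "x \<in> N" using z(2) mem * by blast
      then show ?thesis using x rcos_eq_zero_iff[OF N] by blast
    qed
    moreover have "\<zero>\<^bsub>M QuotMod N\<^esub> \<in> carrier (M QuotMod N)"
      "\<zero>\<^bsub>M QuotMod N\<^esub> \<in> (\<Inter>i\<in>I. quot_submodule M (A i) N)"
      unfolding rcos_zero[OF N] using mem[of "\<zero>\<^bsub>M\<^esub>"] A submoduleD(2)
      by (auto intro: rcos_in_carrier simp del: INT_iff)
    ultimately show "carrier (M QuotMod N) \<inter> (\<Inter>i\<in>I. quot_submodule M (A i) N) = {\<zero>\<^bsub>M QuotMod N\<^esub>}"
      by blast
  qed
qed

text \<open>The canonical map from \<open>M/N\<close> to \<open>M/P\<close> has kernel
  \<open>P/N\<close>, so it is injective on \<open>K\<close>. Thus \<open>K\<close> embeds in the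
  uniform module \<open>M/P\<close> and represents its only associated class.\<close>

lemma As_quot_uniform:
  assumes N: "submodule N R M" and P: "submodule P R M" and NP: "N \<subseteq> P"
    and uni: "uniform_module R (M QuotMod P)"
    and K: "nonzero_submodule R (M QuotMod N) K"
    and KP: "K \<inter> quot_submodule M P N = {\<zero>\<^bsub>M QuotMod N\<^esub>}"
  shows "As R (M QuotMod P) = {ess_class R ((M QuotMod N)\<lparr>carrier := K\<rparr>)}"
proof -
  interpret Q: left_module R "M QuotMod N" using N by (rule quot_module_left_module)
  have lmP: "left_module R (M QuotMod P)" using P by (rule quot_module_left_module)
  have sK: "submodule K R (M QuotMod N)" and K0: "K \<noteq> {\<zero>\<^bsub>M QuotMod N\<^esub>}"
    using K by (auto simp: nonzero_submodule_def)
  have lmK: "left_module R ((M QuotMod N)\<lparr>carrier := K\<rparr>)" using sK by (rule Q.submodule_left_module)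
  have rep: "\<exists>x\<in>carrier M. z = N +>\<^bsub>M\<^esub> x" if "z \<in> K" for z
    using that Q.submoduleD(1)[OF sK] by (blast elim: quot_carrierE)
  note cm = coset_map_rcos[OF N P NP]
  have "essentially_equivalent R ((M QuotMod N)\<lparr>carrier := K\<rparr>) (M QuotMod P)"
  proof (rule essentially_equivalent_if_embeds_in_uniform[OF lmK lmP uni, where h = "coset_map P"])
    show "carrier ((M QuotMod N)\<lparr>carrier := K\<rparr>) \<noteq> {\<zero>\<^bsub>(M QuotMod N)\<lparr>carrier := K\<rparr>\<^esub>}" using K0 by simp
    show "coset_map P \<in> carrier ((M QuotMod N)\<lparr>carrier := K\<rparr>) \<rightarrow> carrier (M QuotMod P)"
      using rep by (auto simp: cm intro!: rcos_in_carrier dest!: rep)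
    show "inj_on (coset_map P) (carrier ((M QuotMod N)\<lparr>carrier := K\<rparr>))"
    proof (rule inj_onI)
      fix z w assume "z \<in> carrier ((M QuotMod N)\<lparr>carrier := K\<rparr>)" "w \<in> carrier ((M QuotMod N)\<lparr>carrier := K\<rparr>)"
        and eq: "coset_map P z = coset_map P w"
      then have zw: "z \<in> K" "w \<in> K" by auto
      obtain x where x: "x \<in> carrier M" "z = N +>\<^bsub>M\<^esub> x" using rep[OF zw(1)] by blast
      obtain y where y: "y \<in> carrier M" "w = N +>\<^bsub>M\<^esub> y" using rep[OF zw(2)] by blast
      have "x \<ominus>\<^bsub>M\<^esub> y \<in> P" using eq x y rcos_eq_iff[OF P] by (simp add: cm)
      then have "N +>\<^bsub>M\<^esub> (x \<ominus>\<^bsub>M\<^esub> y) \<in> quot_submodule M P N" by (auto simp: quot_submodule_def)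
      moreover have "N +>\<^bsub>M\<^esub> (x \<ominus>\<^bsub>M\<^esub> y) = z \<ominus>\<^bsub>M QuotMod N\<^esub> w"
      proof -
        have "z = N +>\<^bsub>M\<^esub> ((x \<ominus>\<^bsub>M\<^esub> y) \<oplus>\<^bsub>M\<^esub> y)" using x y by (simp add: a_minus_def M.a_assoc M.l_neg)
        also have "\<dots> = (N +>\<^bsub>M\<^esub> (x \<ominus>\<^bsub>M\<^esub> y)) \<oplus>\<^bsub>M QuotMod N\<^esub> w"
          using x y by (simp add: rcos_add[OF N])
        finally show ?thesis using Q.add_minus_cancel(2) x y rcos_in_carrier by simp
      qed
      moreover have "z \<ominus>\<^bsub>M QuotMod N\<^esub> w \<in> K" using zw by (rule Q.submoduleD(6)[OF sK])
      ultimately have "z \<ominus>\<^bsub>M QuotMod N\<^esub> w = \<zero>\<^bsub>M QuotMod N\<^esub>" using KP by auto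
      then show "z = w" using Q.minus_eq_zero_iff x y rcos_in_carrier by blast
    qed
  next
    fix z w assume "z \<in> carrier ((M QuotMod N)\<lparr>carrier := K\<rparr>)" "w \<in> carrier ((M QuotMod N)\<lparr>carrier := K\<rparr>)"
    then have zw: "z \<in> K" "w \<in> K" by auto
    obtain x where x: "x \<in> carrier M" "z = N +>\<^bsub>M\<^esub> x" using rep[OF zw(1)] by blast
    obtain y where y: "y \<in> carrier M" "w = N +>\<^bsub>M\<^esub> y" using rep[OF zw(2)] by blast
    from x y show "coset_map P (z \<oplus>\<^bsub>(M QuotMod N)\<lparr>carrier := K\<rparr>\<^esub> w) =
        coset_map P z \<oplus>\<^bsub>M QuotMod P\<^esub> coset_map P w"
      by (simp add: cm rcos_add[OF N, symmetric] rcos_add[OF P, symmetric])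
  next
    fix a z assume "a \<in> carrier R" "z \<in> carrier ((M QuotMod N)\<lparr>carrier := K\<rparr>)"
    then have a: "a \<in> carrier R" and z: "z \<in> K" by auto
    obtain x where "x \<in> carrier M" "z = N +>\<^bsub>M\<^esub> x" using rep[OF z] by blast
    with a show "coset_map P (a \<odot>\<^bsub>(M QuotMod N)\<lparr>carrier := K\<rparr>\<^esub> z) = a \<odot>\<^bsub>M QuotMod P\<^esub> coset_map P z"
      by (simp add: cm rcos_smult[OF N, symmetric] rcos_smult[OF P, symmetric])
  qed
  from ess_class_eqI[OF lmK lmP this] show ?thesis by (simp add: As_uniform_module[OF lmP uni])
qed

end

subsection \<open>Shortest uniform decompositions\<close>

theorem theorem6p4:
  fixes R :: "('r, 's) ring_scheme" and M :: "('r, 'm, 'x) module_scheme"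
    and N :: "'m set" and n :: nat and Ns :: "nat \<Rightarrow> 'm set"
  assumes "left_module R M"
    and "carrier M \<noteq> {\<zero>\<^bsub>M\<^esub>}"
    and "uniformly_finite R M"
    and "submodule N R M"
    and "N \<noteq> carrier M"
    and "shortest_uniform_decomposition R M N n Ns"
  shows
    "(\<exists>U :: nat \<Rightarrow> 'm set set.
       (\<forall>i\<in>{1..n}. uniform_submodule R (M QuotMod N) (U i)) \<and>
       direct_sum (M QuotMod N) {1..n} U \<and>
       (\<forall>i\<in>{1..n}. As R (M QuotMod (Ns i)) = {ess_class R ((M QuotMod N)\<lparr>carrier := U i\<rparr>)}) \<and>
       (\<forall>i\<in>{1..n}. \<exists>C. complement_of R (M QuotMod N) (U i) C \<and>
          submodule_sum (M QuotMod N) ({1..n} - {i}) U \<subseteq> C \<and>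
          submodule_sum (M QuotMod N) ({1..n} - {i}) U \<subseteq> quot_submodule M (Ns i) N \<and>
          quot_submodule M (Ns i) N \<subseteq> C)) \<and>
     (\<forall>(U' :: nat \<Rightarrow> 'm set set) (C' :: nat \<Rightarrow> 'm set set) (Ns' :: nat \<Rightarrow> 'm set).
       (\<forall>i\<in>{1..n}. uniform_submodule R (M QuotMod N) (U' i)) \<and>
       direct_sum (M QuotMod N) {1..n} U' \<and>
       (\<forall>i\<in>{1..n}. complement_of R (M QuotMod N) (U' i) (C' i) \<and>
          submodule_sum (M QuotMod N) ({1..n} - {i}) U' \<subseteq> C' i) \<and>
       (\<forall>i\<in>{1..n}. submodule (Ns' i) R M \<and> N \<subseteq> Ns' i \<and>
          uniform_module R (M QuotMod (Ns' i)) \<and>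
          submodule_sum (M QuotMod N) ({1..n} - {i}) U' \<subseteq> quot_submodule M (Ns' i) N \<and>
          quot_submodule M (Ns' i) N \<subseteq> C' i)
       \<longrightarrow> shortest_uniform_decomposition R M N n Ns' \<and>
           primary_decomposition R M N n Ns' \<and> irredundant M N n Ns')"
proof -

  \<comment> \<open>The given decomposition, read in \<open>M/N\<close>\<close>
  interpret left_module R M by fact
  interpret Q: left_module R "M QuotMod N" using assms(4) by (rule quot_module_left_module)
  note N = assms(4)
  let ?I = "{1..n}"
  let ?quot = "\<lambda>A. quot_submodule M A N"
  have dim: "card ?I = udim R (M QuotMod N)"
    using assms(6) by (simp add: shortest_uniform_decomposition_def)
  have n: "n \<ge> 1" and Ns: "\<And>i. i \<in> ?I \<Longrightarrow> submodule (Ns i) R M"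
    and uni: "\<And>i. i \<in> ?I \<Longrightarrow> uniform_module R (M QuotMod Ns i)"
    and int: "N = (\<Inter>i\<in>?I. Ns i)"
    using assms(6) unfolding shortest_uniform_decomposition_def uniform_decomposition_def by blast+
  have NNs: "N \<subseteq> Ns i" if "i \<in> ?I" for i using that int by blast
  \<comment> \<open>As \<open>n \<ge> 1\<close>, the index \<open>1\<close> is present and the
    intersection already lies in \<open>carrier M\<close>; this links the form used in
    decompositions with that of the counting lemmas.\<close>
  have carrier_INT: "carrier M \<inter> (\<Inter>i\<in>?I. A i) = (\<Inter>i\<in>?I. A i)"
    if "\<And>i. i \<in> ?I \<Longrightarrow> submodule (A i) R M" for A
  proof -
    have "A 1 \<subseteq> carrier M" using n by (intro submoduleD(1) that) auto
    moreover have "(\<Inter>i\<in>?I. A i) \<subseteq> A 1" using n by (intro INF_lower) auto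
    ultimately show ?thesis by blast
  qed
  have irr: "meet_irreducible R (M QuotMod N) (?quot (Ns i))" if "i \<in> ?I" for i
    using that by (intro meet_irreducible_quot_submodule N NNs meet_irreducible_if_uniform_quotient Ns uni)
  have zero: "carrier (M QuotMod N) \<inter> (\<Inter>i\<in>?I. ?quot (Ns i)) = {\<zero>\<^bsub>M QuotMod N\<^esub>}"
    using quot_INT_eq_zero_iff[where A = Ns and I = ?I, OF N Ns NNs]
      carrier_INT[of Ns, OF Ns] int by metis
  define K where "K i = carrier (M QuotMod N) \<inter> (\<Inter>j\<in>?I - {i}. ?quot (Ns j))" for i
  \<comment> \<open>Shortness, that is \<open>n = u.dim(M/N)\<close>, enters here: it makes the
    family of the \<open>N\<^sub>i/N\<close> irredundant.\<close>
  have ne: "carrier (M QuotMod N) \<inter> (\<Inter>j\<in>?I - {i}. ?quot (Ns j)) \<noteq> {\<zero>\<^bsub>M QuotMod N\<^esub>}"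
    if "i \<in> ?I" for i
    by (rule Q.irredundant_if_card_eq_udim[where A = "\<lambda>i. ?quot (Ns i)", OF _ irr zero dim that]) auto
  note family = Q.irredundant_meet_irreducible_family[where A = "\<lambda>i. ?quot (Ns i)",
      OF finite_atLeastAtMost irr zero ne, folded K_def]
  have KN: "K i \<inter> ?quot (Ns i) = {\<zero>\<^bsub>M QuotMod N\<^esub>}" if "i \<in> ?I" for i
    by (rule family(2)) (use that in simp_all)

  \<comment> \<open>The direct sum and the complements belonging to the given decomposition\<close>
  have first: "\<exists>U :: nat \<Rightarrow> 'm set set.
       (\<forall>i\<in>{1..n}. uniform_submodule R (M QuotMod N) (U i)) \<and>
       direct_sum (M QuotMod N) {1..n} U \<and>
       (\<forall>i\<in>{1..n}. As R (M QuotMod (Ns i)) = {ess_class R ((M QuotMod N)\<lparr>carrier := U i\<rparr>)}) \<and>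
       (\<forall>i\<in>{1..n}. \<exists>C. complement_of R (M QuotMod N) (U i) C \<and>
          submodule_sum (M QuotMod N) ({1..n} - {i}) U \<subseteq> C \<and>
          submodule_sum (M QuotMod N) ({1..n} - {i}) U \<subseteq> quot_submodule M (Ns i) N \<and>
          quot_submodule M (Ns i) N \<subseteq> C)"
  proof (intro exI[of _ K] conjI ballI)
    show uK: "uniform_submodule R (M QuotMod N) (K i)" if "i \<in> ?I" for i
      by (rule family(1)) (use that in simp_all)
    show "direct_sum (M QuotMod N) ?I K" by (rule family(4)) simp_all
    fix i assume i: "i \<in> ?I"
    have nK: "nonzero_submodule R (M QuotMod N) (K i)" using uK[OF i] by (simp add: Q.uniform_submodule_iff)
    show "As R (M QuotMod (Ns i)) = {ess_class R ((M QuotMod N)\<lparr>carrier := K i\<rparr>)}"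
      by (rule As_quot_uniform[OF N Ns[OF i] NNs[OF i] uni[OF i] nK KN[OF i]])
    have sum: "submodule_sum (M QuotMod N) (?I - {i}) K \<subseteq> ?quot (Ns i)"
      by (rule family(3)) (use i in simp_all)
    \<comment> \<open>A complement is chosen above \<open>N\<^sub>i/N\<close>, which already
      contains the sum of the other \<open>K j\<close>.\<close>
    have "submodule (K i) R (M QuotMod N)" using nK by (simp add: nonzero_submodule_def)
    then obtain C where "complement_of R (M QuotMod N) (K i) C" "?quot (Ns i) \<subseteq> C"
      using Q.complement_exists[OF _ submodule_quot_submodule[OF N Ns[OF i]] KN[OF i]] by blast
    with sum show "\<exists>C. complement_of R (M QuotMod N) (K i) C \<and>
        submodule_sum (M QuotMod N) (?I - {i}) K \<subseteq> C \<and>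
        submodule_sum (M QuotMod N) (?I - {i}) K \<subseteq> ?quot (Ns i) \<and> ?quot (Ns i) \<subseteq> C"
      by blast
  qed

  \<comment> \<open>The converse construction of shortest decompositions\<close>
  have second: "shortest_uniform_decomposition R M N n Ns' \<and>
      primary_decomposition R M N n Ns' \<and> irredundant M N n Ns'"
    if U: "\<And>i. i \<in> ?I \<Longrightarrow> uniform_submodule R (M QuotMod N) (U i)"
      and dir: "direct_sum (M QuotMod N) ?I U"
      and C: "\<And>i. i \<in> ?I \<Longrightarrow> complement_of R (M QuotMod N) (U i) (C i)"
      and Ns': "\<And>i. i \<in> ?I \<Longrightarrow> submodule (Ns' i) R M"
      and NNs': "\<And>i. i \<in> ?I \<Longrightarrow> N \<subseteq> Ns' i"
      and uni': "\<And>i. i \<in> ?I \<Longrightarrow> uniform_module R (M QuotMod Ns' i)"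
      and sum: "\<And>i. i \<in> ?I \<Longrightarrow> submodule_sum (M QuotMod N) (?I - {i}) U \<subseteq> ?quot (Ns' i)"
      and NC: "\<And>i. i \<in> ?I \<Longrightarrow> ?quot (Ns' i) \<subseteq> C i"
    for U C :: "nat \<Rightarrow> 'm set set" and Ns'
  proof -
    have nU: "nonzero_submodule R (M QuotMod N) (U i)" if "i \<in> ?I" for i
      using U[OF that] by (simp add: Q.uniform_submodule_iff)
    then have sU: "submodule (U i) R (M QuotMod N)" if "i \<in> ?I" for i
      using that by (simp add: nonzero_submodule_def)
    have squot: "submodule (?quot (Ns' i)) R (M QuotMod N)" if "i \<in> ?I" for i
      by (rule submodule_quot_submodule[OF N Ns'[OF that]])
    \<comment> \<open>The original decomposition \<open>Ns\<close> bounds the length of direct sums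
      in \<open>M/N\<close> by \<open>n\<close>, and the given \<open>U i\<close> attain this
      bound.\<close>
    have ess: "essential_submodule R (M QuotMod N) (submodule_sum (M QuotMod N) ?I U)"
      by (rule Q.essential_if_card_eq_udim[where A = "\<lambda>i. ?quot (Ns i)" and U = U, OF _ irr zero nU dir]) auto
    have UN: "U i \<inter> ?quot (Ns' i) = {\<zero>\<^bsub>M QuotMod N\<^esub>}" if i: "i \<in> ?I" for i
    proof -
      have "U i \<inter> C i = {\<zero>\<^bsub>M QuotMod N\<^esub>}" using C[OF i] by (simp add: complement_of_def)
      then have "U i \<inter> ?quot (Ns' i) \<subseteq> {\<zero>\<^bsub>M QuotMod N\<^esub>}" using NC[OF i] by blast
      moreover have "\<zero>\<^bsub>M QuotMod N\<^esub> \<in> U i \<inter> ?quot (Ns' i)"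
        using Q.submoduleD(2)[OF sU[OF i]] Q.submoduleD(2)[OF squot[OF i]] by blast
      ultimately show ?thesis by blast
    qed
    have zero': "carrier (M QuotMod N) \<inter> (\<Inter>i\<in>?I. ?quot (Ns' i)) = {\<zero>\<^bsub>M QuotMod N\<^esub>}"
      by (rule Q.INT_eq_zero_if_essential_sum[where A = "\<lambda>i. ?quot (Ns' i)" and U = U, OF _ sU squot ess UN sum]) auto
    have int': "N = (\<Inter>i\<in>?I. Ns' i)"
      using quot_INT_eq_zero_iff[where A = Ns' and I = ?I, OF N Ns' NNs']
        carrier_INT[of Ns', OF Ns'] zero' by metis
    have "shortest_uniform_decomposition R M N n Ns'"
      using n dim Ns' uni' int'
      unfolding shortest_uniform_decomposition_def uniform_decomposition_def by simp
    \<comment> \<open>Uniform finiteness of \<open>M\<close> gives the finite dimension, and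
      uniformity of the factor module gives the single associated class.\<close>
    moreover have "primary_submodule R M (Ns' i)" if i: "i \<in> ?I" for i
      using assms(3) Ns'[OF i] As_uniform_module[OF quot_module_left_module[OF Ns'[OF i]] uni'[OF i]]
      by (auto simp: primary_submodule_def uniformly_finite_def)
    then have "primary_decomposition R M N n Ns'"
      using n int' unfolding primary_decomposition_def by simp
    \<comment> \<open>\<open>U i\<close> lies in \<open>N\<^sub>j'/N\<close> for every
      \<open>j \<noteq> i\<close>, so an expression of \<open>N\<close> without the component at
      \<open>i\<close> would force \<open>U i\<close> to be zero.\<close>
    moreover have "carrier M \<inter> (\<Inter>j\<in>?I - {i}. Ns' j) \<noteq> N" if i: "i \<in> ?I" for i
    proof
      assume eq: "carrier M \<inter> (\<Inter>j\<in>?I - {i}. Ns' j) = N"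
      have "carrier (M QuotMod N) \<inter> (\<Inter>j\<in>?I - {i}. ?quot (Ns' j)) = {\<zero>\<^bsub>M QuotMod N\<^esub>}"
        using eq Ns' NNs' quot_INT_eq_zero_iff[where A = Ns' and I = "?I - {i}", OF N] by simp
      moreover have "U i \<subseteq> ?quot (Ns' j)" if j: "j \<in> ?I - {i}" for j
      proof -
        have "U i \<subseteq> submodule_sum (M QuotMod N) (?I - {j}) U"
          using i j Q.submoduleD(1)[OF sU[OF i]] by (intro Q.submodule_sum_upper) auto
        then show ?thesis using sum[of j] j by blast
      qed
      moreover have "U i \<subseteq> carrier (M QuotMod N)" by (rule Q.submoduleD(1)[OF sU[OF i]])
      ultimately have "U i \<subseteq> {\<zero>\<^bsub>M QuotMod N\<^esub>}" by blast
      then show False using nU[OF i] Q.submoduleD(2)[OF sU[OF i]] by (auto simp: nonzero_submodule_def)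
    qed
    then have "irredundant M N n Ns'" unfolding irredundant_def by blast
    ultimately show ?thesis by blast
  qed
  show ?thesis
  proof (rule conjI[OF first], intro allI impI, elim conjE)
    fix U' C' :: "nat \<Rightarrow> 'm set set" and Ns' :: "nat \<Rightarrow> 'm set"
    assume *: "\<forall>i\<in>{1..n}. uniform_submodule R (M QuotMod N) (U' i)" "direct_sum (M QuotMod N) {1..n} U'"
      "\<forall>i\<in>{1..n}. complement_of R (M QuotMod N) (U' i) (C' i) \<and>
          submodule_sum (M QuotMod N) ({1..n} - {i}) U' \<subseteq> C' i"
      "\<forall>i\<in>{1..n}. submodule (Ns' i) R M \<and> N \<subseteq> Ns' i \<and>
          uniform_module R (M QuotMod (Ns' i)) \<and>
          submodule_sum (M QuotMod N) ({1..n} - {i}) U' \<subseteq> quot_submodule M (Ns' i) N \<and>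
          quot_submodule M (Ns' i) N \<subseteq> C' i"
    show "shortest_uniform_decomposition R M N n Ns' \<and>
        primary_decomposition R M N n Ns' \<and> irredundant M N n Ns'"
      by (rule second[of U' C' Ns']) (use * in blast)+
  qed
qed

end
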